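(* Fix integers $n>d\ge 2$ and $1\le r\le P(d)$. Then there exists a symmetric ideal $J$ of $R$ generated in degree $d$ with $\dim_k J_d=\dim_k R_d-(P(d)-r)$, and this ideal $J$ is generated by $r$ elements up to symmetry if and only if $$n\ \ge\ 1+\frac{\sum_{i=0}^{d-1}P(i)}{r}.$$
   Context: $k$ is an infinite field with $\operatorname{char}(k)=0$ or $\operatorname{char}(k)>n$; $R=k[x_1,\dots,x_n]$ with the standard grading, and $R_d$, $J_d$ denote degree-$d$ components. $P(i)$ is the number of integer partitions of $i$ (with $P(0)=1$). The symmetric group $\mathfrak{S}_n$ acts on $R$ by $\sigma\cdot f(x_1,\dots,x_n)=f(x_{\sigma(1)},\dots,x_{\sigma(n)})$. A symmetric ideal is an ideal stable under this action. An ideal $J$ is generated by $r$ elements up to symmetry (is $r$-generated) if there exist $r$ homogeneous polynomials $f_1,\dots,f_r\in R$ of the same degree such that $J=(\sigma\cdot f_i:\sigma\in\mathfrak{S}_n,\ 1\le i\le r)$. *)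

theory Defs
  imports Complex_Main "HOL-Library.Poly_Mapping" "HOL-Library.Multiset"
    "HOL-Combinatorics.Permutations"
begin

text \<open>
  \<open>k[x\<^sub>i : i \<in> 'n]\<close>, with \<open>n = card (UNIV :: 'n set)\<close> variables: a polynomial is a finitely supported
  function from exponent vectors to coefficients, multiplication being convolution.
\<close>

type_synonym ('n, 'k) mpoly = "('n \<Rightarrow>\<^sub>0 nat) \<Rightarrow>\<^sub>0 'k"

definition var :: "'n \<Rightarrow> ('n, 'k::field) mpoly" where
  "var i = Poly_Mapping.single (Poly_Mapping.single i 1) 1"

definition const :: "'k \<Rightarrow> ('n, 'k::field) mpoly" where
  "const c = Poly_Mapping.single 0 c"

global_interpretation mpoly_vs: vector_space "\<lambda>(c :: 'k::field) (p :: ('n, 'k) mpoly). const c * p"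
  by unfold_locales (simp_all add: const_def algebra_simps single_add mult_single)

text \<open>
  A commutative ring as a module over itself: \<open>mpoly_ring.subspace\<close> says that a set is an ideal,
  and \<open>mpoly_ring.span S\<close> is the ideal generated by \<open>S\<close>.
\<close>

global_interpretation mpoly_ring: module "(*) :: ('n, 'k::field) mpoly \<Rightarrow> ('n, 'k) mpoly \<Rightarrow> ('n, 'k) mpoly"
  by unfold_locales (simp_all add: algebra_simps)

text \<open>The degree-\<open>d\<close> component of the ring; as usual it contains \<open>0\<close>.\<close>

definition hom_comp :: "nat \<Rightarrow> ('n::finite, 'k::field) mpoly set" where
  "hom_comp d = {f. \<forall>m \<in> Poly_Mapping.keys f. (\<Sum>i\<in>UNIV. Poly_Mapping.lookup m i) = d}"

text \<open>\<open>\<sigma> \<cdot> f\<close>: substitute \<open>x\<^bsub>\<sigma> i\<^esub>\<close> for \<open>x\<^sub>i\<close> in \<open>f\<close>.\<close>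

definition perm_act :: "('n \<Rightarrow> 'n) \<Rightarrow> ('n::finite, 'k::field) mpoly \<Rightarrow> ('n, 'k) mpoly" where
  "perm_act \<sigma> f = (\<Sum>m\<in>Poly_Mapping.keys f.
     const (Poly_Mapping.lookup f m) * (\<Prod>i\<in>UNIV. var (\<sigma> i) ^ Poly_Mapping.lookup m i))"

definition symmetric_ideal :: "('n::finite, 'k::field) mpoly set \<Rightarrow> bool" where
  "symmetric_ideal J \<longleftrightarrow>
     mpoly_ring.subspace J \<and> (\<forall>\<sigma>. \<sigma> permutes UNIV \<longrightarrow> perm_act \<sigma> ` J \<subseteq> J)"

definition generated_in_degree :: "nat \<Rightarrow> ('n::finite, 'k::field) mpoly set \<Rightarrow> bool" where
  "generated_in_degree d J \<longleftrightarrow> (\<exists>S \<subseteq> hom_comp d. J = mpoly_ring.span S)"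

definition generated_up_to_symmetry :: "nat \<Rightarrow> ('n::finite, 'k::field) mpoly set \<Rightarrow> bool" where
  "generated_up_to_symmetry r J \<longleftrightarrow>
     (\<exists>(f :: nat \<Rightarrow> ('n, 'k) mpoly) e. (\<forall>i\<in>{1..r}. f i \<in> hom_comp e) \<and>
        J = mpoly_ring.span {perm_act \<sigma> (f i) | \<sigma> i. \<sigma> permutes UNIV \<and> i \<in> {1..r}})"

text \<open>A partition of \<open>i\<close> is a multiset of positive integers with sum \<open>i\<close>.\<close>

definition num_partitions :: "nat \<Rightarrow> nat" where
  "num_partitions i = card {M :: nat multiset. 0 \<notin># M \<and> sum_mset M = i}"

end

(* A space of polynomials spanned by orbits of monomials is a permutation representation, and
   generating it up to symmetry by r elements means generating it as a k[S_n]-module. A symmetric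
   ideal J as in the statement has J_d = N + W, where N is the kernel of averaging over S_n and W is
   an r-dimensional space of symmetric polynomials, so the question is when N is generated by r
   elements.

   Let Q = P(0) + ... + P(d-1), the multiplicity of the standard representation in R_d. Since that
   representation has dimension n - 1, generation by r elements forces Q <= r (n - 1). Conversely, N is
   generated by r elements once Hom(R_d, Z) has dimension at most r dim Z for every submodule Z of N.
   As R_d is the sum over the partitions mu of d of the permutation modules on the cosets of Young
   subgroups H_mu, this Hom space is the sum of the fixed spaces Z^(H_mu). Let x_i be the dimension of
   the subspace of Z fixed by the first i adjacent transpositions and e_i = x_(i-1) - x_i.
   Submodularity shows that the e_i decrease, and that dim Z^(H_mu) is at most the sum of the e_i over
   the ascents i of the sorted exponent vector of mu. Exactly P(d - (n - i)) partitions have an ascent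
   at i, which increases with i, so Chebyshev's sum inequality gives
   (n - 1) * sum_mu dim Z^(H_mu) <= Q * dim Z. *)

theory Submission
  imports Defs "HOL-Library.Function_Algebras"
begin

section \<open>Dimensions of finite-dimensional subspaces\<close>

text \<open>No decomposition into irreducible modules is used. The bound on Hom spaces is applied to
  one invariant complement \<open>Z\<close> of the span of the orbits of r elements of N: while
  \<open>Z\<close> is nonzero, the r elements can be changed by elements of \<open>Z\<close> so that
  the span grows. Passing from N to N + W costs no further generators, because averaging
  \<open>f + w\<close>, with \<open>f\<close> in N and \<open>w\<close> symmetric, gives back
  \<open>w\<close>.

  The standard representation decides the matter because every estimate is an equality for it: all
  e_i are 1 there, and the subspace fixed by H_mu has as its dimension the number of ascents of mu.
  Chebyshev's inequality expresses that no other submodule of N is more demanding.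

  That the e_i decrease rests on the braid relation. It identifies the intersection of the subspace
  fixed by the first i adjacent transpositions with its translate under the next one.

  For the necessity of the bound no copy of the standard representation is exhibited. Explicit
  coefficient functionals, one for each partition of d and each distinct part of it, are shown to be
  independent on N.\<close>

definition (in vector_space) finite_dim :: "'b set \<Rightarrow> bool" where
  "finite_dim S \<longleftrightarrow> (\<exists>B. finite B \<and> S \<subseteq> span B)"

lemma (in vector_space) finite_dim_subset: "finite_dim T \<Longrightarrow> S \<subseteq> T \<Longrightarrow> finite_dim S"
  unfolding finite_dim_def by blast

text \<open>Coordinates with respect to \<open>C\<close> are unique, so those of \<open>x\<close>
  are supported both in \<open>A\<close> and outside \<open>A\<close>, hence nowhere.\<close>

lemma (in vector_space) span_Int_span_Diff:
  assumes C: "independent C" and AC: "A \<subseteq> C" and x: "x \<in> span A" "x \<in> span (C - A)"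
  shows "x = 0"
proof -
  have "representation C x b = 0" for b
  proof (rule ccontr)
    assume *: "representation C x b \<noteq> 0"
    have "representation C x = representation A x"
      by (rule representation_extend[OF C x(1) AC])
    moreover have "representation C x = representation (C - A) x"
      by (rule representation_extend[OF C x(2)]) auto
    ultimately have "b \<in> A" "b \<in> C - A"
      using * representation_ne_zero by metis+
    then show False by blast
  qed
  moreover have "x \<in> span C" using x(1) AC span_mono by blast
  ultimately show ?thesis using sum_nonzero_representation_eq[OF C] by fastforce
qed

context vector_space_pair
begin

lemma finite_dim_image:
  assumes f: "Vector_Spaces.linear s1 s2 f" and S: "vs1.finite_dim S"
  shows "vs2.finite_dim (f ` S)"
proof -
  obtain B where "finite B" "S \<subseteq> vs1.span B" using S unfolding vs1.finite_dim_def by blast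
  then show ?thesis unfolding vs2.finite_dim_def
    by (intro exI[of _ "f ` B"]) (auto simp: linear_span_image[OF f])
qed

text \<open>A basis \<open>A\<close> of the kernel extends to a basis \<open>C\<close> of
  \<open>S\<close>, and \<open>f\<close> maps \<open>C - A\<close> injectively onto a basis of the
  image. The domain is a subspace because the whole polynomial ring has infinite dimension.\<close>

theorem rank_nullity:
  assumes f: "Vector_Spaces.linear s1 s2 f" and S: "vs1.subspace S" "vs1.finite_dim S"
  shows "vs1.dim S = vs2.dim (f ` S) + vs1.dim {x \<in> S. f x = 0}"
proof -
  let ?K = "{x \<in> S. f x = 0}"
  obtain A where A: "A \<subseteq> ?K" "vs1.independent A" "?K \<subseteq> vs1.span A"
    using vs1.maximal_independent_subset[of ?K] by blast
  have "A \<subseteq> S" using A by blast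
  then obtain C where C: "A \<subseteq> C" "C \<subseteq> S" "vs1.independent C" "S \<subseteq> vs1.span C"
    using vs1.maximal_independent_subset_extend[OF _ A(2)] by blast
  obtain B where B: "finite B" "S \<subseteq> vs1.span B" using S(2) unfolding vs1.finite_dim_def by blast
  have finC: "finite C" using vs1.independent_span_bound[OF B(1) C(3)] B(2) C(2) by blast
  have spC: "vs1.span C = S"
    using C vs1.span_minimal[OF C(2) S(1)] by blast
  have inj: "inj_on f (vs1.span (C - A))"
    unfolding linear_inj_on_iff_eq_0[OF f vs1.subspace_span]
  proof safe
    fix x assume x: "x \<in> vs1.span (C - A)" and "f x = 0"
    moreover have "x \<in> S" using x spC vs1.span_mono[of "C - A" C] by blast
    ultimately have "x \<in> vs1.span A" using A(3) by blast
    then show "x = 0" using vs1.span_Int_span_Diff[OF C(3,1)] x by blast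
  qed
  have injC: "inj_on f (C - A)" using inj vs1.span_superset inj_on_subset by blast
  have "vs1.independent (C - A)" using C(3) vs1.independent_mono by blast
  then have ind: "vs2.independent (f ` (C - A))"
    using linear_independent_injective_image[OF f] inj by blast
  have "f ` S \<subseteq> vs2.span (f ` (C - A))"
  proof -
    have "f ` S = vs2.span (f ` C)" using linear_span_image[OF f, of C] spC by simp
    also have "\<dots> \<subseteq> vs2.span (f ` (C - A))"
    proof (rule vs2.span_minimal[OF _ vs2.subspace_span], safe)
      fix c assume "c \<in> C"
      then show "f c \<in> vs2.span (f ` (C - A))"
        using A(1) vs2.span_zero by (cases "c \<in> A") (auto intro: vs2.span_base)
    qed
    finally show ?thesis .
  qed
  then have "card (f ` (C - A)) = vs2.dim (f ` S)"
    using C(2) ind by (intro vs2.basis_card_eq_dim) auto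
  moreover have "card (f ` (C - A)) = card (C - A)" by (rule card_image[OF injC])
  moreover have "card A = vs1.dim ?K" by (rule vs1.basis_card_eq_dim) (use A in auto)
  moreover have "card C = vs1.dim S" by (rule vs1.basis_card_eq_dim) (use C in auto)
  moreover have "card C = card A + card (C - A)"
    using C(1) finC by (metis card_Diff_subset card_mono finite_subset le_add_diff_inverse)
  ultimately show ?thesis by simp
qed

end

context vector_space
begin

text \<open>Finiteness matters because an infinite basis has \<open>card\<close> 0, so that
  \<open>dim\<close> can be 0 on a large space.\<close>

lemma finite_dim_dim_mono:
  assumes T: "finite_dim T" and ST: "S \<subseteq> T"
  shows "dim S \<le> dim T"
proof -
  obtain A where A: "A \<subseteq> S" "independent A" "S \<subseteq> span A"
    using maximal_independent_subset[of S] by blast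
  have "A \<subseteq> T" using A(1) ST by blast
  then obtain C where C: "A \<subseteq> C" "C \<subseteq> T" "independent C" "T \<subseteq> span C"
    using maximal_independent_subset_extend[OF _ A(2)] by blast
  obtain B where B: "finite B" "T \<subseteq> span B" using T unfolding finite_dim_def by blast
  have "finite C" using independent_span_bound[OF B(1) C(3)] B(2) C(2) by blast
  then have "card A \<le> card C" using C(1) by (intro card_mono)
  then show ?thesis
    using basis_card_eq_dim[OF A(1,3,2)] basis_card_eq_dim[OF C(2,4,3)] by simp
qed

lemma finite_dim_eq_0_iff:
  assumes "finite_dim S" "subspace S"
  shows "dim S = 0 \<longleftrightarrow> S = {0}"
proof
  assume 0: "dim S = 0"
  obtain A where A: "A \<subseteq> S" "independent A" "S \<subseteq> span A" "card A = dim S"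
    using basis_exists[of S] by blast
  obtain B where B: "finite B" "S \<subseteq> span B" using assms unfolding finite_dim_def by blast
  have "finite A" using independent_span_bound[OF B(1) A(2)] B(2) A(1) by blast
  then have "A = {}" using A(4) 0 by simp
  then show "S = {0}" using A(3) subspace_0[OF assms(2)] by auto
next
  assume "S = {0}"
  then have "S \<subseteq> span {}" by (simp add: span_empty)
  then show "dim S = 0" by (intro dim_unique[of "{}"]) (simp_all add: independent_empty)
qed

section \<open>Direct sums encoded as function spaces; dimensions of sums and intersections\<close>

lemma vector_space_fun: "vector_space (\<lambda>c F i. scale c (F i))"
  by unfold_locales (simp_all add: plus_fun_def scale_right_distrib scale_left_distrib)

lemma finite_dim_sums:
  assumes "finite_dim S" "finite_dim T"
  shows "finite_dim {x + y |x y. x \<in> S \<and> y \<in> T}"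
proof -
  obtain A B where "finite A" "finite B" and AB: "S \<subseteq> span A" "T \<subseteq> span B"
    using assms unfolding finite_dim_def by blast
  then show ?thesis unfolding finite_dim_def
    by (intro exI[of _ "A \<union> B"]) (auto intro!: span_add intro: span_mono[THEN subsetD, rotated])
qed

lemma subspace_fun_extend:
  assumes "\<And>i. i \<in> I \<Longrightarrow> subspace (S i)"
  shows "module.subspace (\<lambda>c F i. scale c (F i)) {F. \<forall>i. if i \<in> I then F i \<in> S i else F i = 0}"
proof -
  interpret F: vector_space "\<lambda>c F i. scale c (F i)" by (rule vector_space_fun)
  show ?thesis unfolding F.subspace_def using assms unfolding subspace_def
    by (auto split: if_splits)
qed

text \<open>Evaluation at a new index \<open>j\<close> is onto \<open>S j\<close>, and its kernel
  consists of the tuples over the old index set. The value 0 outside \<open>I\<close> makes a tuple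
  one definite function.\<close>

lemma dim_fun:
  fixes S :: "'i \<Rightarrow> 'b set"
  assumes "finite I" and "\<And>i. i \<in> I \<Longrightarrow> subspace (S i)" and "\<And>i. i \<in> I \<Longrightarrow> finite_dim (S i)"
  defines "P \<equiv> {F. \<forall>i. if i \<in> I then F i \<in> S i else F i = 0}"
  shows "vector_space.dim (\<lambda>c F (i::'i). scale c (F i)) P = (\<Sum>i\<in>I. dim (S i)) \<and>
         vector_space.finite_dim (\<lambda>c F (i::'i). scale c (F i)) P"
  unfolding P_def using assms(1-3)
proof (induction I rule: finite_induct)
  interpret F: vector_space "\<lambda>c F (i::'i). scale c (F i)" by (rule vector_space_fun)
  case empty
  have "{F. \<forall>i. F i = 0} = {0 :: 'i \<Rightarrow> 'b}" by (auto simp: fun_eq_iff)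
  moreover have "F.finite_dim {0}"
    unfolding F.finite_dim_def by (rule exI[of _ "{}"]) (simp add: F.span_zero)
  ultimately show ?case
    using F.finite_dim_eq_0_iff[of "{0}"] F.subspace_single_0 by simp
next
  case (insert j I)
  interpret F: vector_space "\<lambda>c F (i::'i). scale c (F i)" by (rule vector_space_fun)
  interpret FV: vector_space_pair "\<lambda>c F (i::'i). scale c (F i)" scale by unfold_locales
  interpret VF: vector_space_pair scale "\<lambda>c F (i::'i). scale c (F i)" by unfold_locales
  let ?P = "\<lambda>I. {F. \<forall>i. if i \<in> I then F i \<in> S i else F i = 0}"
  have IH: "F.dim (?P I) = (\<Sum>i\<in>I. dim (S i))" "F.finite_dim (?P I)"
    using insert by auto
  have sub: "F.subspace (?P (insert j I))" by (rule subspace_fun_extend) (use insert in auto)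
  have ev: "Vector_Spaces.linear (\<lambda>c F (i::'i). scale c (F i)) scale (\<lambda>F. F j)"
    by (simp add: Vector_Spaces.linear_iff F.vector_space_axioms vector_space_axioms)
  let ?e = "\<lambda>x i. if i = j then x else 0"
  have e: "Vector_Spaces.linear scale (\<lambda>c F (i::'i). scale c (F i)) ?e"
    by (auto simp add: Vector_Spaces.linear_iff F.vector_space_axioms vector_space_axioms fun_eq_iff)
  have finj: "finite_dim (S j)" using insert.prems by blast
  have "?P (insert j I) \<subseteq> {x + y |x y. x \<in> ?e ` S j \<and> y \<in> ?P I}"
  proof safe
    fix F assume F: "\<forall>i. if i \<in> insert j I then F i \<in> S i else F i = 0"
    have "F = ?e (F j) + F(j := 0)" by (auto simp: fun_eq_iff)
    moreover have "F j \<in> S j" using F[rule_format, of j] by simp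
    then have "?e (F j) \<in> ?e ` S j" by (rule imageI)
    moreover have "F(j := 0) \<in> ?P I" using F insert.hyps by auto
    ultimately show "\<exists>x y. F = x + y \<and> x \<in> ?e ` S j \<and> y \<in> ?P I" by blast
  qed
  then have fin: "F.finite_dim (?P (insert j I))"
    by (rule F.finite_dim_subset[OF F.finite_dim_sums[OF VF.finite_dim_image[OF e finj] IH(2)]])
  have "(\<lambda>F. F j) ` ?P (insert j I) = S j"
  proof safe
    fix x assume "x \<in> S j"
    then have "?e x \<in> ?P (insert j I)" using insert by (auto simp: subspace_0)
    then show "x \<in> (\<lambda>F. F j) ` ?P (insert j I)" by (rule rev_image_eqI) simp
  next
    fix F assume "\<forall>i. if i \<in> insert j I then F i \<in> S i else F i = 0"
    from this[rule_format, of j] show "F j \<in> S j" by simp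
  qed
  moreover have "{F \<in> ?P (insert j I). F j = 0} = ?P I"
  proof (intro set_eqI iffI CollectI)
    fix F assume F: "F \<in> {F \<in> ?P (insert j I). F j = 0}"
    show "\<forall>i. if i \<in> I then F i \<in> S i else F i = 0"
    proof
      fix i show "if i \<in> I then F i \<in> S i else F i = 0"
        using F by (cases "i = j") (auto simp: insert.hyps split: if_splits)
    qed
  next
    fix F assume F: "F \<in> ?P I"
    have "F j = 0" using F insert.hyps by auto
    moreover have "0 \<in> S j" using insert.prems(1) by (intro subspace_0) blast
    ultimately show "F \<in> ?P (insert j I) \<and> F j = 0" using F by auto
  qed
  ultimately show ?case
    using FV.rank_nullity[OF ev sub fin] IH insert.hyps fin by (simp only: sum.insert simp_thms)
qed

text \<open>Rank-nullity for addition on \<open>S \<times> T\<close>, pairs being encoded as functions on \<^typ>\<open>bool\<close>.\<close>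

lemma dim_sums_Int:
  assumes S: "subspace S" "finite_dim S" and T: "subspace T" "finite_dim T"
  shows "dim {x + y |x y. x \<in> S \<and> y \<in> T} + dim (S \<inter> T) = dim S + dim T"
proof -
  interpret F: vector_space "\<lambda>c F (i::bool). scale c (F i)" by (rule vector_space_fun)
  interpret FV: vector_space_pair "\<lambda>c F (i::bool). scale c (F i)" scale by unfold_locales
  interpret VF: vector_space_pair scale "\<lambda>c F (i::bool). scale c (F i)" by unfold_locales
  let ?U = "\<lambda>i. if i then S else T"
  let ?P = "{F. \<forall>i. if i \<in> UNIV then F i \<in> ?U i else F i = 0}"
  have P: "F.dim ?P = dim S + dim T" "F.finite_dim ?P"
    using dim_fun[of UNIV ?U] assms by (auto simp: UNIV_bool)
  have sub: "F.subspace ?P" by (rule subspace_fun_extend) (use assms in auto)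
  have add: "Vector_Spaces.linear (\<lambda>c F (i::bool). scale c (F i)) scale (\<lambda>F. F True + F False)"
    by (simp add: Vector_Spaces.linear_iff F.vector_space_axioms vector_space_axioms scale_right_distrib)
  let ?e = "\<lambda>x i. if i then x else - x"
  have e: "Vector_Spaces.linear scale (\<lambda>c F (i::bool). scale c (F i)) ?e"
    by (auto simp add: Vector_Spaces.linear_iff F.vector_space_axioms vector_space_axioms fun_eq_iff)
  have "(\<lambda>F. F True + F False) ` ?P = {x + y |x y. x \<in> S \<and> y \<in> T}"
  proof (intro set_eqI iffI)
    fix z assume "z \<in> {x + y |x y. x \<in> S \<and> y \<in> T}"
    then obtain x y where "z = x + y" "x \<in> S" "y \<in> T" by blast
    then show "z \<in> (\<lambda>F. F True + F False) ` ?P"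
      by (intro image_eqI[of _ _ "\<lambda>i. if i then x else y"]) auto
  next
    fix z assume "z \<in> (\<lambda>F. F True + F False) ` ?P"
    then obtain F where F: "z = F True + F False" "\<forall>i. F i \<in> ?U i" by auto
    from F(2)[rule_format, of True] F(2)[rule_format, of False] F(1)
    show "z \<in> {x + y |x y. x \<in> S \<and> y \<in> T}" by auto
  qed
  moreover have "{F \<in> ?P. F True + F False = 0} = ?e ` (S \<inter> T)"
  proof (intro set_eqI iffI)
    fix F assume "F \<in> {F \<in> ?P. F True + F False = 0}"
    then have F: "\<And>i. F i \<in> ?U i" and 0: "F True + F False = 0" by auto
    from 0 have neg: "F False = - F True" by (metis minus_unique)
    then have "F = ?e (F True)" by (intro ext) simp
    moreover have "F True \<in> S" using F[of True] by simp
    moreover have "F True \<in> T" using F[of False] neg subspace_neg[OF T(1), of "F False"] by simp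
    ultimately show "F \<in> ?e ` (S \<inter> T)" by blast
  next
    fix F assume "F \<in> ?e ` (S \<inter> T)"
    then obtain x where "F = ?e x" "x \<in> S" "x \<in> T" by blast
    then show "F \<in> {F \<in> ?P. F True + F False = 0}" using subspace_neg[OF T(1)] by simp
  qed
  moreover have "F.dim (?e ` (S \<inter> T)) = dim (S \<inter> T)"
  proof -
    have "?e x = 0 \<longleftrightarrow> x = 0" for x :: 'b
    proof
      assume "?e x = 0"
      from fun_cong[OF this, of True] show "x = 0" by simp
    qed (rule ext, simp)
    then have "{x \<in> S \<inter> T. ?e x = 0} = {0}"
      using subspace_0[OF S(1)] subspace_0[OF T(1)] by auto
    moreover have "dim {0} = 0"
      using finite_dim_eq_0_iff[of "{0}"] finite_dim_subset[OF S(2), of "{0}"]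
        subspace_0[OF S(1)] subspace_single_0 by blast
    moreover have "finite_dim (S \<inter> T)" by (rule finite_dim_subset[OF S(2)]) blast
    ultimately show ?thesis
      using VF.rank_nullity[OF e subspace_inter[OF S(1) T(1)]] by simp
  qed
  ultimately show ?thesis
    using FV.rank_nullity[OF add sub P(2)] P(1) by simp
qed

text \<open>The sum of \<open>A\<close> and \<open>B\<close> stays inside \<open>X\<close>, so
  codimension in \<open>X\<close> is subadditive under intersection. The inequalities between fixed
  spaces come from this.\<close>

lemma dim_supermodular:
  assumes "subspace A" "subspace B" "finite_dim X" "subspace X" "A \<subseteq> X" "B \<subseteq> X"
  shows "dim A + dim B \<le> dim X + dim (A \<inter> B)"
proof -
  have "{x + y |x y. x \<in> A \<and> y \<in> B} \<subseteq> X" using assms(4-6) by (auto intro!: subspace_add)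
  from finite_dim_dim_mono[OF assms(3) this] show ?thesis
    using dim_sums_Int[OF assms(1) finite_dim_subset[OF assms(3,5)] assms(2) finite_dim_subset[OF assms(3,6)]]
    by linarith
qed

end

section \<open>Partitions as sorted exponent vectors\<close>

text \<open>Partitions of \<open>d\<close> into at most \<open>n\<close> parts, in increasing order
  and padded in front with zeros, so that they are exponent vectors in \<open>n\<close>
  variables.\<close>

definition sorted_lists :: "nat \<Rightarrow> nat \<Rightarrow> nat list set" where
  "sorted_lists n d = {xs. length xs = n \<and> sorted xs \<and> sum_list xs = d}"

lemma finite_sorted_lists: "finite (sorted_lists n d)"
proof -
  have "sorted_lists n d \<subseteq> {xs. set xs \<subseteq> {..d} \<and> length xs = n}"
    unfolding sorted_lists_def using member_le_sum_list by auto
  then show ?thesis using finite_lists_length_eq[of "{..d}" n] finite_subset by blast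
qed

text \<open>On lists of length \<open>n\<close> with \<open>j < n\<close> this adjoins a part
  \<open>n - j\<close> to the conjugate partition.\<close>

definition raise_tail :: "nat \<Rightarrow> nat list \<Rightarrow> nat list" where
  "raise_tail j ys = take j ys @ map Suc (drop j ys)"

lemma inj_raise_tail: "inj (raise_tail j)"
proof (rule injI)
  fix xs ys assume eq: "raise_tail j xs = raise_tail j ys"
  then have len: "length xs = length ys"
    unfolding raise_tail_def by (metis append_take_drop_id length_append length_map)
  then have "take j xs = take j ys \<and> map Suc (drop j xs) = map Suc (drop j ys)"
    using eq unfolding raise_tail_def by (subst (asm) append_eq_append_conv) simp_all
  then have "take j xs = take j ys" "drop j xs = drop j ys"
    using inj_map_eq_map[OF inj_Suc] by blast+
  then show "xs = ys" by (metis append_take_drop_id)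
qed

lemma sum_list_map_Suc: "sum_list (map Suc xs) = sum_list xs + length xs"
  by (induction xs) auto

lemma raise_tail_in_sorted_lists:
  assumes "ys \<in> sorted_lists n d" "j \<le> n"
  shows "raise_tail j ys \<in> sorted_lists n (d + (n - j))"
proof -
  have ys: "length ys = n" "sorted ys" "sum_list ys = d"
    using assms unfolding sorted_lists_def by auto
  have "sorted (take j ys @ drop j ys)" using ys by simp
  then have "sorted (take j ys @ map Suc (drop j ys))"
    unfolding sorted_append by (auto simp: sorted_iff_nth_mono le_SucI)
  moreover have "sum_list (take j ys) + sum_list (drop j ys) = d"
    using ys(3) by (metis append_take_drop_id sum_list_append)
  ultimately show ?thesis
    using ys assms(2) unfolding raise_tail_def sorted_lists_def by (auto simp: sum_list_map_Suc)
qed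

text \<open>Adding 1 to the last, hence largest, entry is injective.\<close>

lemma card_sorted_lists_mono:
  assumes "n > 0" "i \<le> j"
  shows "card (sorted_lists n i) \<le> card (sorted_lists n j)"
  using assms(2)
proof (induction rule: dec_induct)
  case (step m)
  have "raise_tail (n - 1) ` sorted_lists n m \<subseteq> sorted_lists n (Suc m)"
    using raise_tail_in_sorted_lists[of _ n m "n - 1"] assms(1) by auto
  then have "card (sorted_lists n m) \<le> card (sorted_lists n (Suc m))"
    by (metis card_image card_mono finite_sorted_lists inj_on_subset inj_raise_tail subset_UNIV)
  with step show ?case by linarith
qed simp

text \<open>An ascent at \<open>i\<close> means that the conjugate partition has a part
  \<open>n - 1 - i\<close>; lowering the tail by 1 removes one such part and keeps the list sorted
  because the ascent is strict. If \<open>n - 1 - i\<close> exceeds \<open>d\<close>, the positive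
  tail alone would have too large a sum.\<close>

lemma sorted_lists_ascent:
  assumes i: "i < n - 1"
  shows "{xs \<in> sorted_lists n d. xs ! i < xs ! Suc i} =
    (if n - 1 - i \<le> d then raise_tail (Suc i) ` sorted_lists n (d - (n - 1 - i)) else {})"
proof (intro set_eqI iffI)
  fix xs assume "xs \<in> {xs \<in> sorted_lists n d. xs ! i < xs ! Suc i}"
  then have xs: "length xs = n" "sorted xs" "sum_list xs = d" "xs ! i < xs ! Suc i"
    unfolding sorted_lists_def by auto
  define ys where "ys = take (Suc i) xs @ map (\<lambda>x. x - 1) (drop (Suc i) xs)"
  have "\<forall>x\<in>set (drop (Suc i) xs). xs ! i < x"
    unfolding all_set_conv_all_nth
  proof (intro allI impI)
    fix k assume "k < length (drop (Suc i) xs)"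
    then have "Suc (i + k) < length xs" by simp
    then show "xs ! i < drop (Suc i) xs ! k"
      using sorted_nth_mono[OF xs(2), of "Suc i" "Suc i + k"] xs(4) by simp
  qed
  then have ge: "xs ! i < x" if "x \<in> set (drop (Suc i) xs)" for x using that by blast
  have "\<forall>x\<in>set (take (Suc i) xs). x \<le> xs ! i"
    unfolding all_set_conv_all_nth
  proof (intro allI impI)
    fix k assume "k < length (take (Suc i) xs)"
    then show "take (Suc i) xs ! k \<le> xs ! i"
      using sorted_nth_mono[OF xs(2), of k i] xs(1) i by simp
  qed
  then have le: "x \<le> xs ! i" if "x \<in> set (take (Suc i) xs)" for x using that by blast
  \<comment> \<open>Tail entries exceed \<open>xs ! i\<close>, so they are positive and the
    truncated \<open>x - 1\<close> is undone by \<open>Suc\<close>.\<close>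
  have pos: "map (\<lambda>x. Suc (x - 1)) (drop (Suc i) xs) = drop (Suc i) xs"
    by (rule map_idI) (use ge in fastforce)
  then have xs_eq: "xs = raise_tail (Suc i) ys"
    unfolding raise_tail_def ys_def using xs(1) i by (simp add: o_def min_def)
  have len: "length ys = n" unfolding ys_def using xs(1) i by simp
  have "sorted (drop (Suc i) xs)" using xs(2) by (rule sorted_wrt_drop)
  then have "sorted (map (\<lambda>x. x - 1) (drop (Suc i) xs))"
    by (auto simp: sorted_iff_nth_mono intro: diff_le_mono)
  moreover have "sorted (take (Suc i) xs)" using xs(2) by (rule sorted_wrt_take)
  ultimately have "sorted ys"
    unfolding ys_def sorted_append using ge le by fastforce
  have "sum_list xs = sum_list (take (Suc i) ys) + sum_list (drop (Suc i) ys) + (n - Suc i)"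
    by (subst xs_eq) (simp add: raise_tail_def sum_list_map_Suc len)
  moreover have "sum_list (take (Suc i) ys) + sum_list (drop (Suc i) ys) = sum_list ys"
    by (metis append_take_drop_id sum_list_append)
  ultimately have "sum_list ys + (n - 1 - i) = d" using xs(3) by simp
  then have "n - 1 - i \<le> d" "ys \<in> sorted_lists n (d - (n - 1 - i))"
    using \<open>sorted ys\<close> len unfolding sorted_lists_def by auto
  then show "xs \<in> (if n - 1 - i \<le> d then raise_tail (Suc i) ` sorted_lists n (d - (n - 1 - i)) else {})"
    using xs_eq by auto
next
  fix xs assume "xs \<in> (if n - 1 - i \<le> d then raise_tail (Suc i) ` sorted_lists n (d - (n - 1 - i)) else {})"
  then obtain ys where d: "n - 1 - i \<le> d" and ys: "ys \<in> sorted_lists n (d - (n - 1 - i))"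
    and xs: "xs = raise_tail (Suc i) ys" by (auto split: if_splits)
  have len: "length ys = n" "sorted ys" using ys unfolding sorted_lists_def by auto
  have "d - (n - 1 - i) + (n - Suc i) = d" using d by simp
  then have "xs \<in> sorted_lists n d"
    using raise_tail_in_sorted_lists[OF ys, of "Suc i"] i xs by simp
  moreover have "xs ! i < xs ! Suc i"
  proof -
    have "xs ! i = ys ! i" "xs ! Suc i = Suc (ys ! Suc i)"
      unfolding xs raise_tail_def using len i by (auto simp: nth_append)
    moreover have "ys ! i \<le> ys ! Suc i" using sorted_nth_mono[OF len(2), of i "Suc i"] len i by simp
    ultimately show ?thesis by simp
  qed
  ultimately show "xs \<in> {xs \<in> sorted_lists n d. xs ! i < xs ! Suc i}" by blast
qed

lemma card_sorted_lists_ascent: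
  assumes "i < n - 1"
  shows "card {xs \<in> sorted_lists n d. xs ! i < xs ! Suc i} =
    (if n - 1 - i \<le> d then card (sorted_lists n (d - (n - 1 - i))) else 0)"
  unfolding sorted_lists_ascent[OF assms]
  by (simp add: card_image inj_on_subset[OF inj_raise_tail])

text \<open>As \<open>i\<close> runs from \<open>n - 1 - d\<close> to \<open>n - 2\<close>, the
  number \<open>d - (n - 1 - i)\<close> runs through \<open>0, ..., d - 1\<close>; smaller
  \<open>i\<close> admit no ascent. By \<open>d < n\<close> there are enough positions to reach
  0.\<close>

lemma sum_card_ascents:
  assumes "d < n"
  shows "(\<Sum>i=0..<n - 1. card {xs \<in> sorted_lists n d. xs ! i < xs ! Suc i}) =
    (\<Sum>j<d. card (sorted_lists n j))"
proof -
  have "(\<Sum>i=0..<n - 1. card {xs \<in> sorted_lists n d. xs ! i < xs ! Suc i}) =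
      (\<Sum>i=0..<n - 1. if n - 1 - i \<le> d then card (sorted_lists n (d - (n - 1 - i))) else 0)"
    by (intro sum.cong refl card_sorted_lists_ascent) auto
  also have "\<dots> = (\<Sum>i\<in>{n - 1 - d..<n - 1}. card (sorted_lists n (d - (n - 1 - i))))"
    by (intro sum.mono_neutral_cong_right) auto
  also have "\<dots> = (\<Sum>j<d. card (sorted_lists n j))"
    by (rule sum.reindex_bij_witness[of _ "\<lambda>j. n - 1 - d + j" "\<lambda>i. d - (n - 1 - i)"])
      (use assms in auto)
  finally show ?thesis .
qed

text \<open>Dropping the zeros loses nothing because the length is known, and a partition of
  \<open>d\<close> has at most \<open>d\<close> parts, so it can be padded to length
  \<open>n\<close>.\<close>

lemma card_sorted_lists:
  assumes "d \<le> n"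
  shows "card (sorted_lists n d) = num_partitions d"
proof -
  let ?f = "\<lambda>xs :: nat list. filter_mset (\<lambda>x. x \<noteq> 0) (mset xs)"
  have sum_filter: "sum_mset (filter_mset (\<lambda>x. x \<noteq> 0) M) = sum_mset M" for M :: "nat multiset"
    by (induction M) auto
  have split: "M = filter_mset (\<lambda>x. x \<noteq> 0) M + replicate_mset (count M 0) 0" for M :: "nat multiset"
    by (rule multiset_eqI) auto
  have "bij_betw ?f (sorted_lists n d) {M. 0 \<notin># M \<and> sum_mset M = d}"
  proof (rule bij_betw_imageI)
    show "inj_on ?f (sorted_lists n d)"
    proof (rule inj_onI)
      fix xs ys assume xs: "xs \<in> sorted_lists n d" and ys: "ys \<in> sorted_lists n d" and eq: "?f xs = ?f ys"
      have "size (mset xs) = size (mset ys)" using xs ys unfolding sorted_lists_def by simp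
      then have "count (mset xs) 0 = count (mset ys) 0"
        using eq split[of "mset xs"] split[of "mset ys"]
        by (metis add_left_imp_eq size_replicate_mset size_union)
      then have "mset xs = mset ys" using eq split by metis
      then show "xs = ys" using xs ys unfolding sorted_lists_def
        by (metis (mono_tags, lifting) mem_Collect_eq properties_for_sort)
    qed
    show "?f ` sorted_lists n d = {M. 0 \<notin># M \<and> sum_mset M = d}"
    proof (intro set_eqI iffI)
      fix M assume "M \<in> ?f ` sorted_lists n d"
      then show "M \<in> {M. 0 \<notin># M \<and> sum_mset M = d}"
        unfolding sorted_lists_def using sum_filter by (auto simp: sum_mset_sum_list)
    next
      fix M :: "nat multiset" assume M: "M \<in> {M. 0 \<notin># M \<and> sum_mset M = d}"
      then have M0: "0 \<notin># M" and Md: "sum_mset M = d" by auto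
      from M0 have "size M \<le> sum_mset M" by (induction M) (auto intro: Suc_leI)
      then have size: "size M \<le> n" using assms Md by simp
      let ?xs = "replicate (n - size M) 0 @ sorted_list_of_multiset M"
      have len: "length (sorted_list_of_multiset M) = size M"
        by (metis mset_sorted_list_of_multiset size_mset)
      have "sum_list (sorted_list_of_multiset M) = d"
        using Md by (metis mset_sorted_list_of_multiset sum_mset_sum_list)
      then have xs: "?xs \<in> sorted_lists n d"
        unfolding sorted_lists_def using len size by (auto simp: sorted_append sum_list_replicate)
      have zeros: "filter_mset (\<lambda>x. x \<noteq> 0) (replicate_mset k (0::nat)) = {#}" for k
        by (rule multiset_eqI) (auto simp: count_eq_zero_iff)
      have "filter_mset (\<lambda>x. x \<noteq> 0) M = M"
        by (rule multiset_eqI) (use M0 in \<open>auto simp: not_in_iff\<close>)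
      then have "?f ?xs = M"
        by (simp only: mset_append mset_replicate filter_union_mset mset_sorted_list_of_multiset zeros add_0)
      from this[symmetric] xs show "M \<in> ?f ` sorted_lists n d" by (rule image_eqI)
    qed
  qed
  then show ?thesis unfolding num_partitions_def by (rule bij_betw_same_card)
qed

section \<open>Fixed spaces of Young subgroups\<close>

lemma permutes_UNIV_transpose: "Transposition.transpose a b permutes UNIV"
  by (simp add: permutes_swap_id)

locale perm_rep = vector_space scale
  for scale :: "'k::field \<Rightarrow> 'v::ab_group_add \<Rightarrow> 'v" +
  fixes act :: "('n::finite \<Rightarrow> 'n) \<Rightarrow> 'v \<Rightarrow> 'v"
  assumes act_add: "\<sigma> permutes UNIV \<Longrightarrow> act \<sigma> (x + y) = act \<sigma> x + act \<sigma> y"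
    and act_scale: "\<sigma> permutes UNIV \<Longrightarrow> act \<sigma> (scale c x) = scale c (act \<sigma> x)"
    and act_id: "act id x = x"
    and act_comp: "\<sigma> permutes UNIV \<Longrightarrow> \<tau> permutes UNIV \<Longrightarrow> act (\<sigma> \<circ> \<tau>) x = act \<sigma> (act \<tau> x)"
begin

lemma linear_act: "\<sigma> permutes UNIV \<Longrightarrow> Vector_Spaces.linear scale scale (act \<sigma>)"
  by (simp add: Vector_Spaces.linear_iff vector_space_axioms act_add act_scale)

lemma act_0: "\<sigma> permutes UNIV \<Longrightarrow> act \<sigma> 0 = 0"
  using act_scale[of \<sigma> 0 0] by simp

lemma act_neg: "\<sigma> permutes UNIV \<Longrightarrow> act \<sigma> (- x) = - act \<sigma> x"
  using act_scale[of \<sigma> "-1" x] by simp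

lemma act_diff: "\<sigma> permutes UNIV \<Longrightarrow> act \<sigma> (x - y) = act \<sigma> x - act \<sigma> y"
  using act_add[of \<sigma> x "- y"] by (simp add: act_neg)

lemma act_sum: "\<sigma> permutes UNIV \<Longrightarrow> act \<sigma> (sum f A) = (\<Sum>i\<in>A. act \<sigma> (f i))"
  by (induction A rule: infinite_finite_induct) (simp_all add: act_0 act_add)

lemma act_inv: "\<sigma> permutes UNIV \<Longrightarrow> act (inv \<sigma>) (act \<sigma> x) = x"
  using act_comp[of "inv \<sigma>" \<sigma> x] by (simp add: permutes_inv permutes_inv_o act_id)

lemma act_inv': "\<sigma> permutes UNIV \<Longrightarrow> act \<sigma> (act (inv \<sigma>) x) = x"
  using act_comp[of \<sigma> "inv \<sigma>" x] by (simp add: permutes_inv permutes_inv_o act_id)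

definition stable :: "'v set \<Rightarrow> bool" where
  "stable Z \<longleftrightarrow> (\<forall>\<sigma> z. \<sigma> permutes UNIV \<longrightarrow> z \<in> Z \<longrightarrow> act \<sigma> z \<in> Z)"

lemma dim_act_image:
  assumes "subspace A" "finite_dim A" "\<sigma> permutes UNIV"
  shows "dim (act \<sigma> ` A) = dim A"
proof -
  interpret P: vector_space_pair scale scale by unfold_locales
  have "{x \<in> A. act \<sigma> x = 0} = {0}"
  proof (intro set_eqI iffI)
    fix x assume "x \<in> {x \<in> A. act \<sigma> x = 0}"
    then have "act (inv \<sigma>) (act \<sigma> x) = 0"
      using act_0[OF permutes_inv[OF assms(3)]] by simp
    then show "x \<in> {0}" by (simp add: act_inv[OF assms(3)])
  qed (use assms in \<open>auto simp: act_0 subspace_0\<close>)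
  moreover have "dim {0} = 0"
    using finite_dim_eq_0_iff[of "{0}"] finite_dim_subset[OF assms(2), of "{0}"]
      subspace_0[OF assms(1)] subspace_single_0 by blast
  ultimately show ?thesis using P.rank_nullity[OF linear_act[OF assms(3)] assms(1,2)] by simp
qed

end

section \<open>Fixed spaces along a chain of Young subgroups, in a module without invariants\<close>

locale chain_of_fixed_spaces = perm_rep scale act
  for scale :: "'k::field \<Rightarrow> 'v::ab_group_add \<Rightarrow> 'v" and act :: "('n::finite \<Rightarrow> 'n) \<Rightarrow> 'v \<Rightarrow> 'v" +
  fixes Z :: "'v set" and h :: "nat \<Rightarrow> 'n" and n :: nat
  assumes Z: "subspace Z" "finite_dim Z" "stable Z"
    and no_invariants: "\<And>z. z \<in> Z \<Longrightarrow> (\<And>\<sigma>. \<sigma> permutes UNIV \<Longrightarrow> act \<sigma> z = z) \<Longrightarrow> z = 0"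
    and h: "bij_betw h {..<n} UNIV"
begin

text \<open>The Coxeter generators relative to the numbering \<open>h\<close>; the type of variables
  carries no order of its own.\<close>

definition adj :: "nat \<Rightarrow> 'n \<Rightarrow> 'n" where
  "adj i = Transposition.transpose (h i) (h (Suc i))"

text \<open>The subspace of \<open>Z\<close> fixed by a Young subgroup, described by its generators
  so that a union of index sets gives an intersection of fixed spaces.\<close>

definition fixed :: "nat set \<Rightarrow> 'v set" where
  "fixed E = {z \<in> Z. \<forall>i\<in>E. act (adj i) z = z}"

text \<open>This is e_(k+1) of the overview, positions being counted from 0. The subtraction does
  not truncate, by \<open>drop_dim_add\<close>.\<close>

definition drop_dim :: "nat \<Rightarrow> nat" where
  "drop_dim k = dim (fixed {..<k}) - dim (fixed {..<Suc k})"

lemma adj_permutes: "adj i permutes UNIV"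
  unfolding adj_def by (rule permutes_UNIV_transpose)

lemma fixed_subspace: "subspace (fixed E)"
  using Z(1) unfolding fixed_def subspace_def by (auto simp: act_add act_scale act_0 adj_permutes)

lemma fixed_finite_dim: "finite_dim (fixed E)"
  by (rule finite_dim_subset[OF Z(2)]) (auto simp: fixed_def)

lemma h_eq_iff: "i < n \<Longrightarrow> j < n \<Longrightarrow> h i = h j \<longleftrightarrow> i = j"
  using h unfolding bij_betw_def inj_on_def by auto

lemma drop_dim_add: "drop_dim k + dim (fixed {..<Suc k}) = dim (fixed {..<k})"
proof -
  have "fixed {..<Suc k} \<subseteq> fixed {..<k}" unfolding fixed_def by auto
  then show ?thesis unfolding drop_dim_def using finite_dim_dim_mono[OF fixed_finite_dim] by simp
qed

text \<open>Submodularity: imposing one more adjacent transposition costs at least as many dimensions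
  on a larger fixed space as on a smaller one.\<close>

lemma dim_fixed_le: "dim (fixed (E \<inter> {..<k})) + (\<Sum>i\<in>E \<inter> {..<k}. drop_dim i) \<le> dim Z"
proof (induction k)
  case 0
  then show ?case by (simp add: fixed_def)
next
  case (Suc k)
  show ?case
  proof (cases "k \<in> E")
    case True
    have eq: "E \<inter> {..<Suc k} = insert k (E \<inter> {..<k})" using True by auto
    have le: "dim (fixed {..<k}) + dim (fixed (E \<inter> {..<Suc k})) \<le>
        dim (fixed (E \<inter> {..<k})) + dim (fixed {..<k} \<inter> fixed (E \<inter> {..<Suc k}))"
      by (intro dim_supermodular fixed_subspace fixed_finite_dim) (auto simp: fixed_def)
    have "fixed {..<k} \<inter> fixed (E \<inter> {..<Suc k}) = fixed {..<Suc k}"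
      using True unfolding fixed_def by (auto simp: less_Suc_eq)
    moreover have "(\<Sum>i\<in>E \<inter> {..<Suc k}. drop_dim i) = drop_dim k + (\<Sum>i\<in>E \<inter> {..<k}. drop_dim i)"
      unfolding eq by simp
    ultimately show ?thesis using le Suc.IH drop_dim_add[of k] by simp
  next
    case False
    then have "E \<inter> {..<Suc k} = E \<inter> {..<k}" by (auto simp: less_Suc_eq)
    then show ?thesis using Suc.IH by simp
  qed
qed

text \<open>Let \<open>A\<close> be fixed by the generators up to \<open>k\<close>, and let
  \<open>s\<close> be the next generator. Since \<open>s\<close> commutes with the generators before
  \<open>k\<close>, both \<open>A\<close> and \<open>s A\<close> lie in the space \<open>X\<close>
  fixed by those, and their intersection is fixed by \<open>s\<close> as well. Hence
  \<open>2 * dim A\<close> is at most \<open>dim X\<close> plus the dimension fixed by the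
  generators up to \<open>Suc k\<close>.\<close>

lemma drop_dim_Suc_le:
  assumes k: "Suc (Suc k) < n"
  shows "drop_dim (Suc k) \<le> drop_dim k"
proof -
  let ?s = "adj (Suc k)" and ?t = "adj k"
  let ?X = "fixed {..<k}" and ?A = "fixed {..<Suc k}"
  let ?B = "act ?s ` ?A"
  have hk: "h k \<noteq> h (Suc k)" "h (Suc k) \<noteq> h (Suc (Suc k))" "h k \<noteq> h (Suc (Suc k))"
    using k by (auto simp: h_eq_iff)
  have ss: "?s \<circ> ?s = id" "?t \<circ> ?t = id" unfolding adj_def by auto
  have braid: "?s \<circ> ?t \<circ> ?s = ?t \<circ> ?s \<circ> ?t"
    unfolding adj_def using hk by (auto simp: fun_eq_iff transpose_def)
  have s_s: "act ?s (act ?s z) = z" for z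
    using act_comp[OF adj_permutes adj_permutes, of "Suc k" "Suc k" z] by (simp add: ss act_id)
  have B: "?B \<subseteq> ?X"
  proof
    fix y assume "y \<in> ?B"
    then obtain z where z: "z \<in> ?A" "y = act ?s z" by blast
    have "act (adj i) y = y" if "i < k" for i
    proof -
      have "h i \<noteq> h (Suc k)" "h i \<noteq> h (Suc (Suc k))" "h (Suc i) \<noteq> h (Suc k)" "h (Suc i) \<noteq> h (Suc (Suc k))"
        using k that by (auto simp: h_eq_iff)
      then have "adj i \<circ> ?s = ?s \<circ> adj i"
        unfolding adj_def by (auto simp: fun_eq_iff transpose_def)
      then have "act (adj i) (act ?s z) = act ?s (act (adj i) z)"
        using act_comp[OF adj_permutes adj_permutes] by metis
      then show ?thesis using z that by (simp add: fixed_def)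
    qed
    moreover have "y \<in> Z" using z Z(3) adj_permutes unfolding stable_def fixed_def by blast
    ultimately show "y \<in> ?X" unfolding fixed_def by blast
  qed
  \<comment> \<open>For \<open>y = s z\<close> with \<open>t z = z\<close>, the element
    \<open>s t s\<close> fixes \<open>y\<close>. By the braid relation so does \<open>t s t\<close>,
    and as \<open>t\<close> fixes \<open>y\<close>, it follows that \<open>s\<close> fixes
    \<open>y\<close>.\<close>
  have "?A \<inter> ?B \<subseteq> fixed {..<Suc (Suc k)}"
  proof
    fix y assume y: "y \<in> ?A \<inter> ?B"
    then obtain z where z: "z \<in> ?A" "y = act ?s z" by blast
    have ty: "act ?t y = y" and tz: "act ?t z = z" using y z by (auto simp: fixed_def)
    have "act (?s \<circ> ?t \<circ> ?s) y = y"
      using z tz s_s by (simp add: act_comp adj_permutes permutes_compose)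
    then have "act (?t \<circ> ?s \<circ> ?t) y = y" by (simp only: braid)
    then have "act ?t (act ?s y) = y"
      using ty by (simp add: act_comp adj_permutes permutes_compose)
    then have "act ?t (act ?t (act ?s y)) = y" using ty by simp
    then have "act ?s y = y"
      using act_comp[OF adj_permutes adj_permutes, of k k "act ?s y"] by (simp add: ss act_id)
    then show "y \<in> fixed {..<Suc (Suc k)}" using y by (auto simp: fixed_def less_Suc_eq)
  qed
  then have "dim (?A \<inter> ?B) \<le> dim (fixed {..<Suc (Suc k)})"
    by (rule finite_dim_dim_mono[OF fixed_finite_dim])
  moreover have "dim ?A + dim ?B \<le> dim ?X + dim (?A \<inter> ?B)"
  proof (intro dim_supermodular fixed_subspace fixed_finite_dim B)
    interpret P: vector_space_pair scale scale by unfold_locales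
    show "subspace ?B" by (rule P.linear_subspace_image[OF linear_act[OF adj_permutes] fixed_subspace])
    show "?A \<subseteq> ?X" by (auto simp: fixed_def)
  qed
  moreover have "dim ?B = dim ?A"
    by (rule dim_act_image[OF fixed_subspace fixed_finite_dim adj_permutes])
  ultimately show ?thesis using drop_dim_add[of k] drop_dim_add[of "Suc k"] by linarith
qed

lemma drop_dim_antimono: "i \<le> j \<Longrightarrow> j < n - 1 \<Longrightarrow> drop_dim j \<le> drop_dim i"
proof (induction rule: dec_induct)
  case (step m)
  then have "drop_dim (Suc m) \<le> drop_dim m" using drop_dim_Suc_le[of m] by simp
  with step show ?case by simp
qed simp

text \<open>Adjacent transpositions generate all transpositions by conjugation and hence the whole
  group, so the elements of this space are invariants of \<open>Z\<close>.\<close>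

lemma fixed_all: "fixed {..<n - 1} = {0}"
proof (intro set_eqI iffI)
  fix z assume "z \<in> fixed {..<n - 1}"
  then have z: "z \<in> Z" "\<And>i. Suc i < n \<Longrightarrow> act (adj i) z = z" unfolding fixed_def by auto
  have tr: "act (Transposition.transpose (h i) (h j)) z = z" if "i < j" "j < n" for i j
    using that
  proof (induction j rule: less_induct)
    case (less j)
    show ?case
    proof (cases "j = Suc i")
      case True
      then show ?thesis using z(2)[of i] less.prems unfolding adj_def by simp
    next
      case False
      define m where "m = j - 1"
      have m: "i < m" "j = Suc m" "m < j" using False less.prems unfolding m_def by auto
      have "act (Transposition.transpose (h i) (h m)) z = z" using less.IH[OF m(3)] m less.prems by simp
      moreover have "act (adj m) z = z" using z(2)[of m] m less.prems by simp
      moreover have "Transposition.transpose (h i) (h j) =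
          adj m \<circ> Transposition.transpose (h i) (h m) \<circ> adj m"
      proof -
        have "h i \<noteq> h m" "h i \<noteq> h (Suc m)" "h m \<noteq> h (Suc m)" using m less.prems by (auto simp: h_eq_iff)
        then show ?thesis unfolding adj_def m(2) by (auto simp: fun_eq_iff transpose_def)
      qed
      ultimately show ?thesis
        by (simp only: act_comp adj_permutes permutes_UNIV_transpose permutes_compose)
    qed
  qed
  have tr': "act (Transposition.transpose a b) z = z" for a b
  proof -
    obtain i j where "i < n" "a = h i" "j < n" "b = h j"
      using h unfolding bij_betw_def by (metis UNIV_I imageE lessThan_iff)
    then show ?thesis
      using tr[of i j] tr[of j i] act_id[of z] by (cases i j rule: linorder_cases) (auto simp: transpose_commute id_def)
  qed
  have "act \<sigma> z = z" if "\<sigma> permutes UNIV" for \<sigma>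
    using that finite_UNIV
  proof (induction rule: permutes_induct)
    case id
    then show ?case by (rule act_id)
  next
    case (swap a b p)
    then show ?case
      using tr' by (subst act_comp) (simp_all add: permutes_UNIV_transpose)
  qed
  then show "z \<in> {0}" using no_invariants[OF z(1)] by blast
qed (use fixed_subspace subspace_0 in auto)

text \<open>The sum telescopes down to the zero space: \<open>n - 1\<close> drops account for all of
  \<open>dim Z\<close>. This is where the factor \<open>n - 1\<close> of the criterion comes
  from.\<close>

lemma sum_drop_dim: "(\<Sum>i=0..<n - 1. drop_dim i) = dim Z"
proof -
  have "(\<Sum>i=0..<k. drop_dim i) + dim (fixed {..<k}) = dim Z" for k
  proof (induction k)
    case 0
    then show ?case by (simp add: fixed_def)
  next
    case (Suc k)
    then show ?case using drop_dim_add[of k] by simp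
  qed
  moreover have "dim (fixed {..<n - 1}) = 0"
    using finite_dim_eq_0_iff[OF fixed_finite_dim fixed_subspace] fixed_all by blast
  ultimately show ?thesis by (metis add.right_neutral)
qed

lemma dim_fixed_le_sum:
  assumes "E \<subseteq> {..<n - 1}"
  shows "dim (fixed E) \<le> (\<Sum>i\<in>{0..<n - 1} - E. drop_dim i)"
proof -
  have "E \<inter> {..<n - 1} = E" using assms by blast
  then have "dim (fixed E) + (\<Sum>i\<in>E. drop_dim i) \<le> dim Z" using dim_fixed_le[of E "n - 1"] by simp
  moreover have "(\<Sum>i\<in>E. drop_dim i) + (\<Sum>i\<in>{0..<n - 1} - E. drop_dim i) = dim Z"
    using sum_drop_dim sum.subset_diff[of E "{0..<n - 1}" drop_dim] assms by (auto simp: atLeast0LessThan add.commute)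
  ultimately show ?thesis by linarith
qed

text \<open>Counting pairs of an exponent vector and one of its ascents in two ways turns the left
  sum into one over positions, where the number of vectors increases and \<open>drop_dim\<close>
  decreases.\<close>

theorem sum_dim_fixed_le:
  assumes d: "d < n"
  shows "(n - 1) * (\<Sum>xs\<in>sorted_lists n d. dim (fixed {i. i < n - 1 \<and> xs ! i = xs ! Suc i})) \<le>
    (\<Sum>j<d. card (sorted_lists n j)) * dim Z"
proof -
  let ?c = "\<lambda>i. card {xs \<in> sorted_lists n d. xs ! i < xs ! Suc i}"
  have "(\<Sum>xs\<in>sorted_lists n d. dim (fixed {i. i < n - 1 \<and> xs ! i = xs ! Suc i})) \<le>
      (\<Sum>xs\<in>sorted_lists n d. \<Sum>i=0..<n - 1. if xs ! i < xs ! Suc i then drop_dim i else 0)"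
  proof (rule sum_mono)
    fix xs assume "xs \<in> sorted_lists n d"
    then have xs: "sorted xs" "length xs = n" unfolding sorted_lists_def by auto
    have "xs ! i = xs ! Suc i \<longleftrightarrow> \<not> xs ! i < xs ! Suc i" if "i < n - 1" for i
      using sorted_nth_mono[OF xs(1), of i "Suc i"] xs(2) that by auto
    then have "{0..<n - 1} - {i. i < n - 1 \<and> xs ! i = xs ! Suc i} = {i \<in> {0..<n - 1}. xs ! i < xs ! Suc i}"
      by auto
    then show "dim (fixed {i. i < n - 1 \<and> xs ! i = xs ! Suc i}) \<le>
        (\<Sum>i=0..<n - 1. if xs ! i < xs ! Suc i then drop_dim i else 0)"
      using dim_fixed_le_sum[of "{i. i < n - 1 \<and> xs ! i = xs ! Suc i}"]
      by (auto simp: sum.If_cases Int_def)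
  qed
  also have "\<dots> = (\<Sum>i=0..<n - 1. \<Sum>xs\<in>sorted_lists n d. if xs ! i < xs ! Suc i then drop_dim i else 0)"
    by (rule sum.swap)
  also have "\<dots> = (\<Sum>i=0..<n - 1. ?c i * drop_dim i)"
    by (intro sum.cong refl) (simp add: sum.If_cases finite_sorted_lists Int_def)
  finally have "(n - 1) * (\<Sum>xs\<in>sorted_lists n d. dim (fixed {i. i < n - 1 \<and> xs ! i = xs ! Suc i})) \<le>
      (n - 1) * (\<Sum>i=0..<n - 1. ?c i * drop_dim i)" by (rule mult_le_mono2)
  also have "\<dots> \<le> (\<Sum>i=0..<n - 1. ?c i) * (\<Sum>i=0..<n - 1. drop_dim i)"
  proof (rule Chebyshev_sum_upper_nat)
    fix i j assume ij: "i \<le> j" "j < n - 1"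
    have "card (sorted_lists n (d - (n - 1 - i))) \<le> card (sorted_lists n (d - (n - 1 - j)))"
      using ij by (intro card_sorted_lists_mono) auto
    then show "?c i \<le> ?c j" using ij by (auto simp: card_sorted_lists_ascent)
    show "drop_dim j \<le> drop_dim i" using drop_dim_antimono ij by blast
  qed
  finally show ?thesis unfolding sum_drop_dim sum_card_ascents[OF d] .
qed

end

section \<open>Generation of permutation representations\<close>

context perm_rep
begin

text \<open>The submodule generated by \<open>S\<close> over the group algebra.\<close>

definition orbit_span :: "'v set \<Rightarrow> 'v set" where
  "orbit_span S = span {act \<sigma> s |\<sigma> s. \<sigma> permutes UNIV \<and> s \<in> S}"

lemma subspace_orbit_span: "subspace (orbit_span S)"
  unfolding orbit_span_def by (rule subspace_span)

lemma orbit_span_base: "\<sigma> permutes UNIV \<Longrightarrow> s \<in> S \<Longrightarrow> act \<sigma> s \<in> orbit_span S"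
  unfolding orbit_span_def by (rule span_base) blast

lemma orbit_span_superset: "S \<subseteq> orbit_span S"
  using orbit_span_base[OF permutes_id] act_id by (metis subsetI)

lemma orbit_span_minimal:
  assumes "S \<subseteq> Y" "subspace Y" "stable Y"
  shows "orbit_span S \<subseteq> Y"
  unfolding orbit_span_def
  by (rule span_minimal) (use assms in \<open>auto simp: stable_def\<close>)

lemma stable_orbit_span: "stable (orbit_span S)"
  unfolding stable_def
proof (intro allI impI)
  fix \<tau> :: "'n \<Rightarrow> 'n" and z assume \<tau>: "\<tau> permutes UNIV" and "z \<in> orbit_span S"
  interpret P: vector_space_pair scale scale by unfold_locales
  let ?G = "{act \<sigma> s |\<sigma> s. \<sigma> permutes UNIV \<and> s \<in> S}"
  have "act \<tau> ` ?G \<subseteq> ?G"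
  proof
    fix x assume "x \<in> act \<tau> ` ?G"
    then obtain \<sigma> s where x: "x = act \<tau> (act \<sigma> s)" "\<sigma> permutes UNIV" "s \<in> S" by blast
    then have "x = act (\<tau> \<circ> \<sigma>) s" using act_comp[OF \<tau>] by simp
    then show "x \<in> ?G" using x(2,3) permutes_compose[OF x(2) \<tau>] by blast
  qed
  then have "span (act \<tau> ` ?G) \<subseteq> span ?G" by (rule span_mono)
  then have "act \<tau> ` span ?G \<subseteq> span ?G" using P.linear_span_image[OF linear_act[OF \<tau>]] by metis
  then show "act \<tau> z \<in> orbit_span S" using \<open>z \<in> orbit_span S\<close> unfolding orbit_span_def by blast
qed

lemma stable_sums:
  assumes "stable Y" "stable Z"
  shows "stable {y + z |y z. y \<in> Y \<and> z \<in> Z}"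
  using assms act_add unfolding stable_def by (smt (verit) mem_Collect_eq)

text \<open>The Reynolds operator. It projects onto the invariants once \<open>n!\<close> is nonzero
  in the field, which is assumed in \<open>nonmodular_perm_rep\<close>.\<close>

definition avg :: "'v \<Rightarrow> 'v" where
  "avg x = scale (inverse (of_nat (fact (card (UNIV :: 'n set))))) (\<Sum>\<sigma> | \<sigma> permutes UNIV. act \<sigma> x)"

end

lemma sum_permutes_right:
  assumes "\<tau> permutes S"
  shows "(\<Sum>\<sigma> | \<sigma> permutes S. f (\<sigma> \<circ> \<tau>)) = (\<Sum>\<sigma> | \<sigma> permutes S. f \<sigma>)"
  using sum_permutations_compose_right[OF assms, of f] by simp

lemma sum_permutes_left:
  assumes "\<tau> permutes S"
  shows "(\<Sum>\<sigma> | \<sigma> permutes S. f (\<tau> \<circ> \<sigma>)) = (\<Sum>\<sigma> | \<sigma> permutes S. f \<sigma>)"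
  using setum_permutations_compose_left[OF assms, of f] by simp

section \<open>Averaging and complete reducibility when \<open>n!\<close> is invertible\<close>

locale nonmodular_perm_rep = perm_rep scale act
  for scale :: "'k::field \<Rightarrow> 'v::ab_group_add \<Rightarrow> 'v" and act :: "('n::finite \<Rightarrow> 'n) \<Rightarrow> 'v \<Rightarrow> 'v" +
  assumes fact_nonzero: "(of_nat (fact (card (UNIV :: 'n set))) :: 'k) \<noteq> 0"
begin

lemma linear_avg: "Vector_Spaces.linear scale scale avg"
proof -
  have "avg (x + y) = avg x + avg y" for x y
    unfolding avg_def by (simp add: act_add sum.distrib scale_right_distrib)
  moreover have "avg (scale c x) = scale c (avg x)" for c x
    unfolding avg_def by (simp add: act_scale scale_sum_right[symmetric] mult.commute)
  ultimately show ?thesis by (simp add: Vector_Spaces.linear_iff vector_space_axioms)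
qed

lemma avg_add: "avg (x + y) = avg x + avg y"
  using linear_avg unfolding Vector_Spaces.linear_iff by blast

lemma avg_scale: "avg (scale c x) = scale c (avg x)"
  using linear_avg unfolding Vector_Spaces.linear_iff by blast

lemma avg_diff: "avg (x - y) = avg x - avg y"
  using avg_add[of x "scale (-1) y"] avg_scale[of "-1" y] by simp

lemma avg_act:
  assumes "\<tau> permutes UNIV"
  shows "avg (act \<tau> x) = avg x"
proof -
  have "(\<Sum>\<sigma> | \<sigma> permutes UNIV. act \<sigma> (act \<tau> x)) = (\<Sum>\<sigma> | \<sigma> permutes UNIV. act (\<sigma> \<circ> \<tau>) x)"
    by (intro sum.cong refl) (use act_comp assms in auto)
  then show ?thesis unfolding avg_def by (simp only: sum_permutes_right[OF assms, of "\<lambda>\<sigma>. act \<sigma> x"])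
qed

lemma act_avg:
  assumes "\<tau> permutes UNIV"
  shows "act \<tau> (avg x) = avg x"
proof -
  have "act \<tau> (\<Sum>\<sigma> | \<sigma> permutes UNIV. act \<sigma> x) = (\<Sum>\<sigma> | \<sigma> permutes UNIV. act (\<tau> \<circ> \<sigma>) x)"
    unfolding act_sum[OF assms] by (intro sum.cong refl) (use act_comp assms in auto)
  also have "\<dots> = (\<Sum>\<sigma> | \<sigma> permutes UNIV. act \<sigma> x)"
    by (rule sum_permutes_left[OF assms])
  finally show ?thesis unfolding avg_def act_scale[OF assms] by simp
qed

text \<open>Stated for a general summand \<open>g\<close> so that it serves both \<open>avg\<close>
  and the averaged projection in \<open>maschke\<close>.\<close>

lemma avg_average:
  assumes "\<And>\<sigma>. \<sigma> permutes UNIV \<Longrightarrow> g \<sigma> = x"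
  shows "scale (inverse (of_nat (fact (card (UNIV :: 'n set))))) (\<Sum>\<sigma> | \<sigma> permutes (UNIV :: 'n set). g \<sigma>) = x"
proof -
  have "(\<Sum>\<sigma> | \<sigma> permutes (UNIV :: 'n set). g \<sigma>) = (\<Sum>\<sigma> | \<sigma> permutes (UNIV :: 'n set). x)"
    by (intro sum.cong refl) (use assms in auto)
  also have "\<dots> = scale (of_nat (card {\<sigma>. \<sigma> permutes (UNIV :: 'n set)})) x"
    by (rule sum_constant_scale)
  also have "card {\<sigma>. \<sigma> permutes (UNIV :: 'n set)} = fact (card (UNIV :: 'n set))"
    by (rule card_permutations) simp_all
  finally show ?thesis using fact_nonzero by simp
qed

lemma avg_fixed: "(\<And>\<sigma>. \<sigma> permutes UNIV \<Longrightarrow> act \<sigma> x = x) \<Longrightarrow> avg x = x"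
  unfolding avg_def by (rule avg_average)

lemma avg_avg: "avg (avg x) = avg x"
  by (rule avg_fixed) (rule act_avg)

lemma avg_in:
  assumes "subspace Y" "stable Y" "x \<in> Y"
  shows "avg x \<in> Y"
  unfolding avg_def
  by (intro subspace_scale subspace_sum assms(1)) (use assms in \<open>auto simp: stable_def\<close>)

text \<open>Averaging the conjugates of a linear projection onto \<open>Y\<close> gives an
  equivariant projection \<open>q\<close> onto \<open>Y\<close>; its kernel in \<open>N\<close> is
  the complement.\<close>

theorem maschke:
  assumes Y: "subspace Y" "stable Y" "Y \<subseteq> N" and N: "subspace N" "stable N"
  obtains Z where "subspace Z" "stable Z" "Z \<subseteq> N" "Y \<inter> Z = {0}" "\<And>x. x \<in> N \<Longrightarrow> \<exists>y\<in>Y. x - y \<in> Z"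
proof -
  interpret P: vector_space_pair scale scale by unfold_locales
  obtain C where C: "C \<subseteq> Y" "independent C" "Y \<subseteq> span C"
    using maximal_independent_subset by blast
  have spC: "span C = Y" using C span_minimal[OF C(1) Y(1)] by blast
  \<comment> \<open>A linear projection onto \<open>Y\<close>, obtained by extending the identity
    from the basis \<open>C\<close>; it need not be equivariant.\<close>
  define p where "p = P.construct C (\<lambda>x. x)"
  have lp: "Vector_Spaces.linear scale scale p"
    unfolding p_def by (rule P.linear_construct[OF C(2)])
  have pY: "p x \<in> Y" for x
    using P.construct_in_span[OF C(2), of "\<lambda>x. x" x] spC unfolding p_def by simp
  have lid: "Vector_Spaces.linear scale scale (\<lambda>x. x)"
    by (simp add: Vector_Spaces.linear_iff vector_space_axioms)
  have p_id: "p y = y" if "y \<in> Y" for y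
    using P.linear_eq_on[OF lp lid, of y C] P.construct_basis[OF C(2), of _ "\<lambda>x. x"] that spC
    unfolding p_def by blast
  define q where "q x = scale (inverse (of_nat (fact (card (UNIV :: 'n set)))))
    (\<Sum>\<sigma> | \<sigma> permutes UNIV. act \<sigma> (p (act (inv \<sigma>) x)))" for x
  have qY: "q x \<in> Y" for x
    unfolding q_def by (intro subspace_scale subspace_sum Y(1)) (use Y(2) pY in \<open>auto simp: stable_def\<close>)
  have q_id: "q y = y" if "y \<in> Y" for y
    unfolding q_def
  proof (rule avg_average)
    fix \<sigma> :: "'n \<Rightarrow> 'n" assume \<sigma>: "\<sigma> permutes UNIV"
    then have "act (inv \<sigma>) y \<in> Y" using Y(2) that permutes_inv unfolding stable_def by blast
    then show "act \<sigma> (p (act (inv \<sigma>) y)) = y" by (simp add: p_id act_inv'[OF \<sigma>])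
  qed
  have p_add: "p (x + y) = p x + p y" and p_scale: "p (scale c x) = scale c (p x)" for x y c
    using lp unfolding Vector_Spaces.linear_iff by blast+
  have q_add: "q (x + y) = q x + q y" for x y
    unfolding q_def by (simp add: permutes_inv act_add p_add sum.distrib scale_right_distrib)
  have q_scale: "q (scale c x) = scale c (q x)" for c x
    unfolding q_def by (simp add: permutes_inv act_scale p_scale scale_sum_right[symmetric] mult.commute)
  have q_act: "q (act \<tau> x) = act \<tau> (q x)" if \<tau>: "\<tau> permutes UNIV" for \<tau> x
  proof -
    have *: "act (\<tau> \<circ> \<sigma>) (p (act (inv (\<tau> \<circ> \<sigma>)) (act \<tau> x))) = act \<tau> (act \<sigma> (p (act (inv \<sigma>) x)))"
      if \<sigma>: "\<sigma> permutes UNIV" for \<sigma>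
    proof -
      have "inv (\<tau> \<circ> \<sigma>) = inv \<sigma> \<circ> inv \<tau>"
        using o_inv_distrib[of \<tau> \<sigma>] \<sigma> \<tau> permutes_bij by blast
      then have "act (inv (\<tau> \<circ> \<sigma>)) (act \<tau> x) = act (inv \<sigma>) (act (inv \<tau>) (act \<tau> x))"
        using act_comp[OF permutes_inv[OF \<sigma>] permutes_inv[OF \<tau>]] by simp
      then show ?thesis using act_comp[OF \<tau> \<sigma>] act_inv[OF \<tau>] by simp
    qed
    have "(\<Sum>\<sigma> | \<sigma> permutes UNIV. act \<sigma> (p (act (inv \<sigma>) (act \<tau> x)))) =
        (\<Sum>\<sigma> | \<sigma> permutes UNIV. act (\<tau> \<circ> \<sigma>) (p (act (inv (\<tau> \<circ> \<sigma>)) (act \<tau> x))))"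
      by (rule sum_permutes_left[OF \<tau>, symmetric])
    also have "\<dots> = (\<Sum>\<sigma> | \<sigma> permutes UNIV. act \<tau> (act \<sigma> (p (act (inv \<sigma>) x))))"
      by (intro sum.cong refl) (use * in auto)
    finally show ?thesis unfolding q_def act_scale[OF \<tau>] act_sum[OF \<tau>] by simp
  qed
  have q_0: "q 0 = 0" using q_scale[of 0 0] by simp
  have q_diff: "q (x - y) = q x - q y" for x y
    using q_add[of x "scale (-1) y"] q_scale[of "-1" y] by simp
  define Z where "Z = {x \<in> N. q x = 0}"
  show thesis
  proof (rule that)
    show "subspace Z" using N(1) unfolding Z_def subspace_def by (auto simp: q_add q_scale q_0)
    show "stable Z" using N(2) unfolding Z_def stable_def by (auto simp: q_act act_0)
    show "Z \<subseteq> N" unfolding Z_def by blast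
    show "Y \<inter> Z = {0}"
      using q_id subspace_0[OF Y(1)] subspace_0[OF N(1)] unfolding Z_def by (auto simp: q_0)
    show "\<exists>y\<in>Y. x - y \<in> Z" if "x \<in> N" for x
    proof
      show "q x \<in> Y" by (rule qY)
      show "x - q x \<in> Z"
        using subspace_diff[OF N(1) that] qY[of x] Y(3) q_id[OF qY[of x]] unfolding Z_def by (auto simp: q_diff)
    qed
  qed
qed

end

section \<open>Equivariant maps out of a permutation representation, and generation of
  \<open>N\<close>\<close>

locale perm_basis_rep = nonmodular_perm_rep scale act
  for scale :: "'k::field \<Rightarrow> 'v::ab_group_add \<Rightarrow> 'v" and act :: "('n::finite \<Rightarrow> 'n) \<Rightarrow> 'v \<Rightarrow> 'v" +
  fixes B :: "'v set" and I :: "'i set" and rep_of :: "'i \<Rightarrow> 'v"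
  assumes B: "finite B" "independent B"
    and act_basis: "\<And>\<sigma> b. \<sigma> permutes UNIV \<Longrightarrow> b \<in> B \<Longrightarrow> act \<sigma> b \<in> B"
    and I: "finite I"
    and rep_of: "\<And>i. i \<in> I \<Longrightarrow> rep_of i \<in> B"
    and orbit_ex: "\<And>b. b \<in> B \<Longrightarrow> \<exists>i\<in>I. \<exists>\<sigma>. \<sigma> permutes UNIV \<and> act \<sigma> (rep_of i) = b"
begin

definition U :: "'v set" where "U = span B"

definition N :: "'v set" where "N = {x \<in> U. avg x = 0}"

lemma U: "subspace U" "finite_dim U" "stable U"
proof -
  show "subspace U" unfolding U_def by (rule subspace_span)
  show "finite_dim U" unfolding U_def finite_dim_def using B(1) by blast
  have "orbit_span B \<subseteq> U"
    unfolding orbit_span_def U_def by (rule span_mono) (use act_basis in blast)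
  moreover have "U \<subseteq> orbit_span B"
    unfolding U_def by (rule span_minimal[OF orbit_span_superset subspace_orbit_span])
  ultimately have "U = orbit_span B" by blast
  then show "stable U" using stable_orbit_span by simp
qed

lemma N: "subspace N" "finite_dim N" "stable N"
proof -
  show "subspace N"
    using U(1) avg_scale[of 0 0] unfolding N_def subspace_def by (auto simp: avg_add avg_scale)
  show "finite_dim N" by (rule finite_dim_subset[OF U(2)]) (auto simp: N_def)
  show "stable N" using U(3) unfolding N_def stable_def by (auto simp: avg_act)
qed

lemma minus_avg_in_N: "x \<in> U \<Longrightarrow> x - avg x \<in> N"
  unfolding N_def using subspace_diff[OF U(1)] avg_in[OF U(1,3)] by (simp add: avg_diff avg_avg)

definition index_of :: "'v \<Rightarrow> 'i" where
  "index_of b = (SOME i. i \<in> I \<and> (\<exists>\<sigma>. \<sigma> permutes UNIV \<and> act \<sigma> (rep_of i) = b))"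

definition perm_to :: "'v \<Rightarrow> 'n \<Rightarrow> 'n" where
  "perm_to b = (SOME \<sigma>. \<sigma> permutes UNIV \<and> act \<sigma> (rep_of (index_of b)) = b)"

lemma index_of: "b \<in> B \<Longrightarrow> index_of b \<in> I"
  and perm_to: "b \<in> B \<Longrightarrow> perm_to b permutes UNIV" "b \<in> B \<Longrightarrow> act (perm_to b) (rep_of (index_of b)) = b"
proof -
  assume b: "b \<in> B"
  have *: "index_of b \<in> I \<and> (\<exists>\<sigma>. \<sigma> permutes UNIV \<and> act \<sigma> (rep_of (index_of b)) = b)"
    using orbit_ex[OF b] unfolding index_of_def Bex_def by (rule someI_ex)
  then show "index_of b \<in> I" by blast
  have "perm_to b permutes UNIV \<and> act (perm_to b) (rep_of (index_of b)) = b"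
    using conjunct2[OF *] unfolding perm_to_def by (rule someI_ex)
  then show "perm_to b permutes UNIV" "act (perm_to b) (rep_of (index_of b)) = b" by blast+
qed

text \<open>Evaluation on \<open>U\<close> of the equivariant map determined by the images \<open>F i\<close> of the orbit
  representatives.\<close>

definition ext :: "('i \<Rightarrow> 'v) \<Rightarrow> 'v \<Rightarrow> 'v" where
  "ext F x = (\<Sum>b\<in>B. scale (representation B x b) (act (perm_to b) (F (index_of b))))"

text \<open>By Frobenius reciprocity these are the possible images of \<open>rep_of i\<close> under
  equivariant maps from the span of its orbit into \<open>Z\<close>.\<close>

definition stab_fixed :: "'v set \<Rightarrow> 'i \<Rightarrow> 'v set" where
  "stab_fixed Z i = {z \<in> Z. \<forall>\<sigma>. \<sigma> permutes UNIV \<longrightarrow> act \<sigma> (rep_of i) = rep_of i \<longrightarrow> act \<sigma> z = z}"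

text \<open>Stands for the space of equivariant maps from \<open>U\<close> to \<open>Z\<close>, with
  one admissible image for each orbit representative.\<close>

definition hom_data :: "'v set \<Rightarrow> ('i \<Rightarrow> 'v) set" where
  "hom_data Z = {F. \<forall>i. if i \<in> I then F i \<in> stab_fixed Z i else F i = 0}"

lemma ext_add: "x \<in> U \<Longrightarrow> y \<in> U \<Longrightarrow> ext F (x + y) = ext F x + ext F y"
  unfolding ext_def U_def by (simp add: representation_add[OF B(2)] scale_left_distrib sum.distrib)

lemma ext_add_fun: "ext (F + G) x = ext F x + ext G x"
  unfolding ext_def sum.distrib[symmetric]
  by (intro sum.cong refl) (simp add: perm_to act_add scale_right_distrib)

lemma ext_scale_fun: "ext (\<lambda>i. scale c (F i)) x = scale c (ext F x)"
  unfolding ext_def scale_sum_right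
  by (intro sum.cong refl) (simp add: perm_to act_scale mult.commute)

lemma ext_in: "F \<in> hom_data Z \<Longrightarrow> subspace Z \<Longrightarrow> stable Z \<Longrightarrow> ext F x \<in> Z"
  unfolding ext_def
proof (intro subspace_sum subspace_scale)
  fix b assume F: "F \<in> hom_data Z" "stable Z" and b: "b \<in> B"
  have "F (index_of b) \<in> Z"
    using F(1) index_of[OF b] unfolding hom_data_def stab_fixed_def by (auto split: if_splits)
  then show "act (perm_to b) (F (index_of b)) \<in> Z" using F(2) perm_to(1)[OF b] unfolding stable_def by blast
qed

text \<open>The map \<open>x - avg x\<close> takes \<open>U\<close> to \<open>N\<close>, and
  projecting further to \<open>Z\<close> along \<open>Y\<close> gives an equivariant map;
  \<open>F\<close> records its values at the representatives. Uniqueness of the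
  \<open>Z\<close>-component makes these values fixed by the stabilisers.\<close>

lemma hom_data_projection:
  assumes Y: "subspace Y" "stable Y" and Z: "subspace Z" "stable Z"
    and YZ: "Y \<inter> Z = {0}" "\<And>x. x \<in> N \<Longrightarrow> \<exists>y\<in>Y. x - y \<in> Z"
  obtains F where "F \<in> hom_data Z" "\<And>x. x \<in> N \<Longrightarrow> x - ext F x \<in> Y"
proof -
  have unique: "z = z'" if "z \<in> Z" "z' \<in> Z" "x - z \<in> Y" "x - z' \<in> Y" for x z z'
  proof -
    have "(x - z') - (x - z) \<in> Y" using subspace_diff[OF Y(1)] that by blast
    moreover have "z - z' \<in> Z" using subspace_diff[OF Z(1)] that by blast
    ultimately have "z - z' \<in> Y \<inter> Z" by simp
    then show ?thesis using YZ(1) by simp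
  qed
  define A where "A x = x - avg x" for x
  have A_act: "A (act \<sigma> x) = act \<sigma> (A x)" if "\<sigma> permutes UNIV" for \<sigma> x
    unfolding A_def using that by (simp add: act_diff avg_act act_avg)
  have ex: "\<exists>z\<in>Z. A (rep_of i) - z \<in> Y" if "i \<in> I" for i
  proof -
    have "rep_of i \<in> U" using rep_of[OF that] unfolding U_def by (rule span_base)
    then obtain y where "y \<in> Y" "A (rep_of i) - y \<in> Z" using YZ(2) minus_avg_in_N unfolding A_def by blast
    then show ?thesis by (intro bexI[of _ "A (rep_of i) - y"]) auto
  qed
  define F where "F i = (if i \<in> I then SOME z. z \<in> Z \<and> A (rep_of i) - z \<in> Y else 0)" for i
  have F: "F i \<in> Z" "A (rep_of i) - F i \<in> Y" if "i \<in> I" for i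
    using someI_ex[OF ex[OF that, unfolded Bex_def]] that unfolding F_def by auto
  have "F i \<in> stab_fixed Z i" if i: "i \<in> I" for i
    unfolding stab_fixed_def
  proof (intro CollectI conjI allI impI)
    fix \<sigma> :: "'n \<Rightarrow> 'n" assume \<sigma>: "\<sigma> permutes UNIV" and stab: "act \<sigma> (rep_of i) = rep_of i"
    have "act \<sigma> (A (rep_of i) - F i) \<in> Y" using F(2)[OF i] Y(2) \<sigma> unfolding stable_def by blast
    then have "A (rep_of i) - act \<sigma> (F i) \<in> Y" using A_act[OF \<sigma>, of "rep_of i"] stab by (simp add: act_diff \<sigma>)
    moreover have "act \<sigma> (F i) \<in> Z" using F(1)[OF i] Z(2) \<sigma> unfolding stable_def by blast
    ultimately show "act \<sigma> (F i) = F i" using unique F[OF i] by blast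
  qed (rule F(1)[OF i])
  then have hd: "F \<in> hom_data Z" unfolding hom_data_def by (auto simp: F_def)
  have "x - ext F x \<in> Y" if x: "x \<in> N" for x
  proof -
    have xU: "x \<in> span B" and A: "A x = x" using x unfolding N_def U_def A_def by auto
    have A_add: "A (u + v) = A u + A v" and A_scale: "A (scale c u) = scale c (A u)" for u v c
      unfolding A_def by (simp_all add: avg_add avg_scale scale_right_diff_distrib)
    have A_sum: "A (\<Sum>b\<in>S. g b) = (\<Sum>b\<in>S. A (g b))" for g and S :: "'v set"
      using A_scale[of 0 0] by (induction S rule: infinite_finite_induct) (simp_all add: A_add)
    \<comment> \<open>Single basis vectors need not lie in \<open>N\<close>, but \<open>A b\<close>
      does, and \<open>x = A x\<close> because \<open>avg x = 0\<close>.\<close>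
    have "x = A (\<Sum>b\<in>B. scale (representation B x b) b)"
      using sum_representation_eq[OF B(2) xU B(1)] A by simp
    also have "\<dots> = (\<Sum>b\<in>B. scale (representation B x b) (A b))" by (simp add: A_sum A_scale)
    finally have "x - ext F x = (\<Sum>b\<in>B. scale (representation B x b) (A b - act (perm_to b) (F (index_of b))))"
      unfolding ext_def by (simp add: sum_subtractf scale_right_diff_distrib)
    also have "\<dots> \<in> Y"
    proof (intro subspace_sum subspace_scale Y(1))
      fix b assume b: "b \<in> B"
      have "act (perm_to b) (A (rep_of (index_of b)) - F (index_of b)) \<in> Y"
        using F(2)[OF index_of[OF b]] Y(2) perm_to(1)[OF b] unfolding stable_def by blast
      then show "A b - act (perm_to b) (F (index_of b)) \<in> Y"
        using A_act[OF perm_to(1)[OF b], of "rep_of (index_of b)"] by (simp add: act_diff perm_to[OF b])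
    qed
    finally show ?thesis .
  qed
  with hd show thesis using that by blast
qed

lemma dim_hom_data:
  assumes Z: "subspace Z" "finite_dim Z"
  shows "vector_space.dim (\<lambda>c F i. scale c (F i)) (hom_data Z) = (\<Sum>i\<in>I. dim (stab_fixed Z i))"
    and "vector_space.finite_dim (\<lambda>c F i. scale c (F i)) (hom_data Z)"
    and "module.subspace (\<lambda>c F i. scale c (F i)) (hom_data Z)"
proof -
  have sub: "subspace (stab_fixed Z i)" for i
    using Z(1) unfolding stab_fixed_def subspace_def by (auto simp: act_add act_scale act_0)
  moreover have "finite_dim (stab_fixed Z i)" for i
    by (rule finite_dim_subset[OF Z(2)]) (auto simp: stab_fixed_def)
  ultimately show "vector_space.dim (\<lambda>c F i. scale c (F i)) (hom_data Z) = (\<Sum>i\<in>I. dim (stab_fixed Z i))"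
    and "vector_space.finite_dim (\<lambda>c F i. scale c (F i)) (hom_data Z)"
    using dim_fun[OF I, of "stab_fixed Z"] unfolding hom_data_def by blast+
  show "module.subspace (\<lambda>c F i. scale c (F i)) (hom_data Z)"
    unfolding hom_data_def by (rule subspace_fun_extend) (rule sub)
qed

text \<open>If the orbits of \<open>f\<close> do not span \<open>N\<close>, let \<open>Z\<close> be an invariant complement of their span. The
  evaluation \<open>F \<mapsto> (ext F (f j))\<^sub>j\<close> of equivariant maps into \<open>Z\<close> kills the projection to \<open>Z\<close>, so by
  the dimension bound it misses some \<open>G\<close>; adding \<open>G\<close> to \<open>f\<close> enlarges the span.\<close>

lemma enlarge_orbit_span:
  assumes f: "\<And>j. j \<in> {1..r} \<Longrightarrow> f j \<in> N" and ne: "orbit_span (f ` {1..r}) \<noteq> N"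
    and bound: "\<And>Z. subspace Z \<Longrightarrow> stable Z \<Longrightarrow> Z \<subseteq> N \<Longrightarrow> (\<Sum>i\<in>I. dim (stab_fixed Z i)) \<le> r * dim Z"
  shows "\<exists>f'. (\<forall>j\<in>{1..r}. f' j \<in> N) \<and> dim (orbit_span (f ` {1..r})) < dim (orbit_span (f' ` {1..r}))"
proof -
  let ?Y = "orbit_span (f ` {1..r})"
  have Y: "subspace ?Y" "stable ?Y" "?Y \<subseteq> N"
    by (rule subspace_orbit_span stable_orbit_span orbit_span_minimal[OF image_subsetI[OF f] N(1,3)])+
  obtain Z where Z: "subspace Z" "stable Z" "Z \<subseteq> N" "?Y \<inter> Z = {0}"
    and YZ: "\<And>x. x \<in> N \<Longrightarrow> \<exists>y\<in>?Y. x - y \<in> Z"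
    using maschke[OF Y N(1,3)] by blast
  have finZ: "finite_dim Z" by (rule finite_dim_subset[OF N(2) Z(3)])
  have Z_ne: "Z \<noteq> {0}"
  proof
    assume "Z = {0}"
    then have "N \<subseteq> ?Y" using YZ by fastforce
    then show False using ne Y(3) by blast
  qed
  interpret FI: vector_space "\<lambda>c F (i::'i). scale c (F i)" by (rule vector_space_fun)
  interpret FR: vector_space "\<lambda>c F (j::nat). scale c (F j)" by (rule vector_space_fun)
  interpret FP: vector_space_pair "\<lambda>c F (i::'i). scale c (F i)" "\<lambda>c F (j::nat). scale c (F j)"
    by unfold_locales
  define T where "T F = (\<lambda>j. if j \<in> {1..r} then ext F (f j) else 0)" for F
  have lT: "Vector_Spaces.linear (\<lambda>c F (i::'i). scale c (F i)) (\<lambda>c F (j::nat). scale c (F j)) T"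
    unfolding Vector_Spaces.linear_iff T_def
    by (intro conjI FI.vector_space_axioms FR.vector_space_axioms allI ext)
      (simp_all add: ext_add_fun ext_scale_fun)
  let ?P = "{G. \<forall>j. if j \<in> {1..r} then G j \<in> Z else G j = 0}"
  have P: "FR.dim ?P = r * dim Z" "FR.finite_dim ?P"
    using dim_fun[of "{1..r}" "\<lambda>_. Z"] Z(1) finZ by simp_all
  have TP: "T ` hom_data Z \<subseteq> ?P" unfolding T_def using ext_in[OF _ Z(1,2)] by auto
  obtain F0 where F0: "F0 \<in> hom_data Z" "\<And>x. x \<in> N \<Longrightarrow> x - ext F0 x \<in> ?Y"
    using hom_data_projection[OF Y(1,2) Z(1,2,4) YZ] by blast
  \<comment> \<open>\<open>ext F0\<close> agrees on \<open>N\<close> with the projection to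
    \<open>Z\<close> along \<open>?Y\<close>, which kills \<open>f j\<close>.\<close>
  have "T F0 = 0"
  proof
    fix j
    have "ext F0 (f j) = 0" if j: "j \<in> {1..r}"
    proof -
      have "f j \<in> ?Y" using j orbit_span_superset by blast
      moreover have "f j - ext F0 (f j) \<in> ?Y" using F0(2) f[OF j] by blast
      ultimately have "f j - (f j - ext F0 (f j)) \<in> ?Y" using subspace_diff[OF Y(1)] by blast
      then have "ext F0 (f j) \<in> ?Y \<inter> Z" using ext_in[OF F0(1) Z(1,2)] by simp
      then show ?thesis unfolding Z(4) by blast
    qed
    then show "T F0 j = 0 j" unfolding T_def by simp
  qed
  moreover have "F0 \<noteq> 0"
  proof
    assume F00: "F0 = 0"
    obtain z where z: "z \<in> Z" "z \<noteq> 0" using Z_ne subspace_0[OF Z(1)] by blast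
    have "ext F0 z = 0" unfolding ext_def F00 by (simp add: perm_to act_0)
    then have "z \<in> ?Y" using F0(2)[of z] z Z(3) by auto
    then show False using z Z(4) by blast
  qed
  ultimately have "{F \<in> hom_data Z. T F = 0} \<noteq> {0}" using F0(1) by blast
  moreover have "FI.finite_dim {F \<in> hom_data Z. T F = 0}"
    by (rule FI.finite_dim_subset[OF dim_hom_data(2)[OF Z(1) finZ]]) blast
  moreover have "FI.subspace {F \<in> hom_data Z. T F = 0}"
  proof -
    have "{F \<in> hom_data Z. T F = 0} = hom_data Z \<inter> {F. T F = 0}" by blast
    then show ?thesis
      using FI.subspace_inter[OF dim_hom_data(3)[OF Z(1) finZ] FP.linear_subspace_kernel[OF lT]] by simp
  qed
  ultimately have "0 < FI.dim {F \<in> hom_data Z. T F = 0}"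
    using FI.finite_dim_eq_0_iff by blast
  \<comment> \<open>The nonzero kernel makes the rank strictly smaller than a dimension that is
    itself at most \<open>r * dim Z\<close>.\<close>
  then have "FR.dim (T ` hom_data Z) < FI.dim (hom_data Z)"
    using FP.rank_nullity[OF lT dim_hom_data(3)[OF Z(1) finZ] dim_hom_data(2)[OF Z(1) finZ]] by linarith
  also have "\<dots> \<le> FR.dim ?P"
    using bound[OF Z(1,2,3)] P(1) dim_hom_data(1)[OF Z(1) finZ] by linarith
  finally have "T ` hom_data Z \<noteq> ?P" by (metis less_irrefl)
  then obtain G where G: "G \<in> ?P" "G \<notin> T ` hom_data Z" using TP by blast
  have GZ: "G j \<in> Z" if "j \<in> {1..r}" for j using G(1) that by auto
  define f' where "f' j = f j + G j" for j
  let ?Y' = "orbit_span (f' ` {1..r})"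
  have f': "f' j \<in> N" if "j \<in> {1..r}" for j
    unfolding f'_def using f[OF that] GZ[OF that] Z(3) subspace_add[OF N(1)] by blast
  have Y': "subspace ?Y'" "stable ?Y'" "?Y' \<subseteq> N"
    by (rule subspace_orbit_span stable_orbit_span orbit_span_minimal[OF image_subsetI[OF f'] N(1,3)])+
  let ?S = "{y + z |y z. y \<in> ?Y' \<and> z \<in> Z}"
  have S: "subspace ?S" "stable ?S" using subspace_sums[OF Y'(1) Z(1)] stable_sums[OF Y'(2) Z(2)] by auto
  have "f j \<in> ?S" if j: "j \<in> {1..r}" for j
  proof -
    have "f j = f' j + (- G j)" unfolding f'_def by simp
    moreover have "f' j \<in> ?Y'" using j orbit_span_superset by blast
    moreover have "- G j \<in> Z" using GZ[OF j] subspace_neg[OF Z(1)] by blast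
    ultimately show ?thesis by blast
  qed
  then have YS: "?Y \<subseteq> ?S" by (intro orbit_span_minimal S) blast
  have ZS: "Z \<subseteq> ?S" using subspace_0[OF Y'(1)] by (metis (mono_tags, lifting) add_0 mem_Collect_eq subsetI)
  have NS: "N = ?S"
  proof
    show "N \<subseteq> ?S"
    proof
      fix x assume "x \<in> N"
      then obtain y where y: "y \<in> ?Y" "x - y \<in> Z" using YZ by blast
      then have "y + (x - y) \<in> ?S" using YS ZS subspace_add[OF S(1)] by blast
      then show "x \<in> ?S" by simp
    qed
    show "?S \<subseteq> N" using Y'(3) Z(3) subspace_add[OF N(1)] by blast
  qed
  \<comment> \<open>Otherwise \<open>N\<close> would split as \<open>?Y'\<close> and
    \<open>Z\<close>, and the projection to \<open>Z\<close> would be given by some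
    \<open>F\<close>. It kills \<open>f' j = f j + G j\<close> and fixes \<open>G j\<close>, so it
    sends \<open>f j\<close> to \<open>- G j\<close>; then \<open>G\<close> would be the image under
    \<open>T\<close> of the negative of \<open>F\<close>.\<close>
  have "?Y' \<inter> Z \<noteq> {0}"
  proof
    assume 0: "?Y' \<inter> Z = {0}"
    have "\<exists>y\<in>?Y'. x - y \<in> Z" if xN: "x \<in> N" for x
    proof -
      obtain y z where "y \<in> ?Y'" "z \<in> Z" "x = y + z"
        using equalityD1[OF NS, THEN subsetD, OF xN] by blast
      then show ?thesis by (intro bexI[of _ y]) auto
    qed
    then obtain F where F: "F \<in> hom_data Z" "\<And>x. x \<in> N \<Longrightarrow> x - ext F x \<in> ?Y'"
      using hom_data_projection[OF Y'(1,2) Z(1,2) 0] by blast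
    have ext_f: "ext F (f j) = - G j" if j: "j \<in> {1..r}" for j
    proof -
      have "f' j \<in> ?Y'" using j orbit_span_superset by blast
      moreover have "f' j - ext F (f' j) \<in> ?Y'" using F(2) f'[OF j] by blast
      ultimately have "f' j - (f' j - ext F (f' j)) \<in> ?Y'" using subspace_diff[OF Y'(1)] by blast
      then have "ext F (f' j) \<in> ?Y' \<inter> Z" using ext_in[OF F(1) Z(1,2)] by simp
      then have "ext F (f' j) = 0" unfolding 0 by blast
      moreover have "ext F (G j) = G j"
      proof -
        have "G j - ext F (G j) \<in> ?Y'" using F(2) GZ[OF j] Z(3) by blast
        moreover have "G j - ext F (G j) \<in> Z"
          using subspace_diff[OF Z(1) GZ[OF j] ext_in[OF F(1) Z(1,2)]] .
        ultimately have "G j - ext F (G j) \<in> ?Y' \<inter> Z" by blast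
        then have "G j - ext F (G j) = 0" unfolding 0 by blast
        then show ?thesis by simp
      qed
      moreover have "ext F (f' j) = ext F (f j) + ext F (G j)"
        unfolding f'_def using f[OF j] GZ[OF j] Z(3) by (intro ext_add) (auto simp: N_def)
      ultimately show ?thesis by (simp add: eq_neg_iff_add_eq_0)
    qed
    let ?F = "\<lambda>i. scale (-1) (F i)"
    have "?F \<in> hom_data Z" using FI.subspace_scale[OF dim_hom_data(3)[OF Z(1) finZ] F(1)] .
    moreover have "T ?F = G"
    proof
      fix j show "T ?F j = G j"
        using ext_f[of j] G(1) ext_scale_fun[of "-1" F "f j"] unfolding T_def by (auto split: if_splits)
    qed
    ultimately show False using G(2) by blast
  qed
  \<comment> \<open>Both \<open>?Y\<close> and \<open>?Y'\<close> together with \<open>Z\<close>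
    span \<open>N\<close>, but only the sum with \<open>?Y\<close> is direct, so \<open>?Y'\<close>
    has the larger dimension.\<close>
  then have "0 < dim (?Y' \<inter> Z)"
    using finite_dim_eq_0_iff[OF finite_dim_subset[OF finZ] subspace_inter[OF Y'(1) Z(1)]] by blast
  moreover have "dim ?S + dim (?Y' \<inter> Z) = dim ?Y' + dim Z"
    by (rule dim_sums_Int[OF Y'(1) finite_dim_subset[OF N(2) Y'(3)] Z(1) finZ])
  moreover have "dim ?Y + dim Z \<le> dim N"
  proof -
    have "dim ?Y + dim Z \<le> dim N + dim (?Y \<inter> Z)"
      by (rule dim_supermodular[OF Y(1) Z(1) N(2,1) Y(3) Z(3)])
    moreover have "dim (?Y \<inter> Z) = 0"
      using finite_dim_eq_0_iff[OF finite_dim_subset[OF finZ] subspace_inter[OF Y(1) Z(1)]] Z(4) by blast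
    ultimately show ?thesis by simp
  qed
  ultimately have "dim ?Y < dim ?Y'" unfolding NS by linarith
  then show ?thesis using f' by blast
qed

text \<open>Among all r-tuples in \<open>N\<close>, one whose orbit span has maximal dimension
  cannot be enlarged.\<close>

theorem ex_orbit_span_eq_N:
  assumes bound: "\<And>Z. subspace Z \<Longrightarrow> stable Z \<Longrightarrow> Z \<subseteq> N \<Longrightarrow> (\<Sum>i\<in>I. dim (stab_fixed Z i)) \<le> r * dim Z"
  obtains f :: "nat \<Rightarrow> 'v" where "\<And>j. j \<in> {1..r} \<Longrightarrow> f j \<in> N" "orbit_span (f ` {1..r}) = N"
proof -
  let ?Q = "\<lambda>f :: nat \<Rightarrow> 'v. \<forall>j\<in>{1..r}. f j \<in> N"
  have "\<exists>f. ?Q f \<and> (\<forall>g. ?Q g \<longrightarrow> dim (orbit_span (g ` {1..r})) \<le> dim (orbit_span (f ` {1..r})))"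
  proof (rule ex_has_greatest_nat)
    show "?Q (\<lambda>_. 0)" using subspace_0[OF N(1)] by blast
    show "\<forall>g. ?Q g \<longrightarrow> dim (orbit_span (g ` {1..r})) < Suc (dim N)"
    proof (intro allI impI)
      fix g assume "?Q g"
      then have "orbit_span (g ` {1..r}) \<subseteq> N" by (intro orbit_span_minimal N) blast
      then show "dim (orbit_span (g ` {1..r})) < Suc (dim N)" using finite_dim_dim_mono[OF N(2)] by (simp add: less_Suc_eq_le)
    qed
  qed
  then obtain f where f: "?Q f" "\<And>g. ?Q g \<Longrightarrow> dim (orbit_span (g ` {1..r})) \<le> dim (orbit_span (f ` {1..r}))"
    by blast
  have "orbit_span (f ` {1..r}) = N"
  proof (rule ccontr)
    assume "orbit_span (f ` {1..r}) \<noteq> N"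
    from enlarge_orbit_span[OF _ this bound] f(1)
    obtain f' where "?Q f'" "dim (orbit_span (f ` {1..r})) < dim (orbit_span (f' ` {1..r}))" by blast
    then show False using f(2) by fastforce
  qed
  then show thesis using that f(1) by blast
qed

end

section \<open>Polynomials and the action of permutations\<close>

definition exp_of :: "('n::finite \<Rightarrow> nat) \<Rightarrow> ('n \<Rightarrow>\<^sub>0 nat)" where
  "exp_of f = Abs_poly_mapping f"

lemma lookup_exp_of [simp]: "Poly_Mapping.lookup (exp_of f) = f"
  unfolding exp_of_def by (rule Abs_poly_mapping_inverse) simp

lemma exp_of_lookup [simp]: "exp_of (Poly_Mapping.lookup m) = m"
  unfolding exp_of_def by (rule poly_mapping.lookup_inverse)

definition exps :: "nat \<Rightarrow> ('n::finite \<Rightarrow>\<^sub>0 nat) set" where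
  "exps d = {m. (\<Sum>i\<in>UNIV. Poly_Mapping.lookup m i) = d}"

lemma finite_exps: "finite (exps d :: ('n::finite \<Rightarrow>\<^sub>0 nat) set)"
proof -
  have "Poly_Mapping.lookup ` (exps d :: ('n \<Rightarrow>\<^sub>0 nat) set) \<subseteq> {f. \<forall>i. (i \<in> UNIV \<longrightarrow> f i \<in> {..d}) \<and> (i \<notin> UNIV \<longrightarrow> f i = 0)}"
  proof
    fix f :: "'n \<Rightarrow> nat" assume "f \<in> Poly_Mapping.lookup ` exps d"
    then have "sum f UNIV = d" unfolding exps_def by auto
    then have "f i \<le> d" for i using member_le_sum[of i UNIV f] by simp
    then show "f \<in> {f. \<forall>i. (i \<in> UNIV \<longrightarrow> f i \<in> {..d}) \<and> (i \<notin> UNIV \<longrightarrow> f i = 0)}" by simp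
  qed
  moreover have "finite {f :: 'n \<Rightarrow> nat. \<forall>i. (i \<in> UNIV \<longrightarrow> f i \<in> {..d}) \<and> (i \<notin> UNIV \<longrightarrow> f i = 0)}"
    by (rule finite_set_of_finite_funs) simp_all
  ultimately have "finite (Poly_Mapping.lookup ` (exps d :: ('n \<Rightarrow>\<^sub>0 nat) set))" by (rule finite_subset)
  then show ?thesis by (rule finite_imageD) (auto intro: inj_onI simp: poly_mapping.lookup_inject)
qed

lemma hom_comp_iff: "f \<in> hom_comp d \<longleftrightarrow> (\<forall>m. Poly_Mapping.lookup f m \<noteq> 0 \<longrightarrow> m \<in> exps d)"
  unfolding hom_comp_def exps_def by (auto simp: in_keys_iff)

lemma sum_single_lookup:
  "(\<Sum>m\<in>Poly_Mapping.keys f. Poly_Mapping.single m (Poly_Mapping.lookup f m)) = f"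
proof (rule poly_mapping_eqI)
  fix k
  have "Poly_Mapping.lookup (\<Sum>m\<in>Poly_Mapping.keys f. Poly_Mapping.single m (Poly_Mapping.lookup f m)) k =
      (\<Sum>m\<in>Poly_Mapping.keys f. if m = k then Poly_Mapping.lookup f m else 0)"
    unfolding lookup_sum by (intro sum.cong refl) (simp add: lookup_single when_def)
  also have "\<dots> = Poly_Mapping.lookup f k" by (simp add: in_keys_iff)
  finally show "Poly_Mapping.lookup (\<Sum>m\<in>Poly_Mapping.keys f. Poly_Mapping.single m (Poly_Mapping.lookup f m)) k =
      Poly_Mapping.lookup f k" .
qed

lemma const_mult_single: "const c * Poly_Mapping.single m a = Poly_Mapping.single m (c * a)"
  unfolding const_def by (simp add: mult_single)

lemma lookup_const_mult: "Poly_Mapping.lookup (const c * f) m = c * Poly_Mapping.lookup f m"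
proof -
  have "const c * f = (\<Sum>m\<in>Poly_Mapping.keys f. Poly_Mapping.single m (c * Poly_Mapping.lookup f m))"
    by (subst sum_single_lookup[of f, symmetric]) (simp only: sum_distrib_left const_mult_single)
  then have "Poly_Mapping.lookup (const c * f) m =
      (\<Sum>k\<in>Poly_Mapping.keys f. if k = m then c * Poly_Mapping.lookup f k else 0)"
    by (simp add: lookup_sum lookup_single when_def)
  then show ?thesis by (simp add: in_keys_iff)
qed

text \<open>Substituting the variable \<open>\<sigma> i\<close> for \<open>i\<close> moves an
  exponent from \<open>i\<close> to \<open>\<sigma> i\<close>, hence the inverse in the
  formula.\<close>

definition perm_exp :: "('n \<Rightarrow> 'n) \<Rightarrow> ('n::finite \<Rightarrow>\<^sub>0 nat) \<Rightarrow> ('n \<Rightarrow>\<^sub>0 nat)" where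
  "perm_exp \<sigma> m = exp_of (\<lambda>i. Poly_Mapping.lookup m (inv \<sigma> i))"

lemma lookup_perm_exp [simp]: "Poly_Mapping.lookup (perm_exp \<sigma> m) i = Poly_Mapping.lookup m (inv \<sigma> i)"
  unfolding perm_exp_def by simp

lemma perm_exp_eq_iff:
  assumes "\<sigma> permutes UNIV"
  shows "perm_exp \<sigma> m = m' \<longleftrightarrow> m = exp_of (\<lambda>i. Poly_Mapping.lookup m' (\<sigma> i))"
proof
  assume "perm_exp \<sigma> m = m'"
  then have "Poly_Mapping.lookup m' (\<sigma> i) = Poly_Mapping.lookup m i" for i
    using permutes_inverses(2)[OF assms] by auto
  then show "m = exp_of (\<lambda>i. Poly_Mapping.lookup m' (\<sigma> i))" by simp
next
  assume "m = exp_of (\<lambda>i. Poly_Mapping.lookup m' (\<sigma> i))"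
  then show "perm_exp \<sigma> m = m'"
    by (intro poly_mapping_eqI) (simp add: permutes_inverses(1)[OF assms])
qed

lemma perm_exp_in_exps:
  assumes "\<sigma> permutes UNIV"
  shows "perm_exp \<sigma> m \<in> exps d \<longleftrightarrow> m \<in> exps d"
proof -
  have "(\<Sum>i\<in>UNIV. Poly_Mapping.lookup m (inv \<sigma> i)) = (\<Sum>i\<in>UNIV. Poly_Mapping.lookup m i)"
    using sum.permute[OF permutes_inv[OF assms], of "Poly_Mapping.lookup m"] by (simp add: o_def)
  then show ?thesis unfolding exps_def by simp
qed

lemma var_power: "var i ^ k = Poly_Mapping.single (Poly_Mapping.single i k) 1"
  by (induction k) (simp_all add: var_def mult_single single_add[symmetric])

lemma prod_single: "(\<Prod>i\<in>A. Poly_Mapping.single (a i) 1) = Poly_Mapping.single (\<Sum>i\<in>A. a i) (1::'k::comm_semiring_1)"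
  by (induction A rule: infinite_finite_induct) (simp_all add: mult_single)

lemma perm_act_altdef:
  assumes "\<sigma> permutes UNIV"
  shows "perm_act \<sigma> f = (\<Sum>m\<in>Poly_Mapping.keys f. Poly_Mapping.single (perm_exp \<sigma> m) (Poly_Mapping.lookup f m))"
proof -
  have "(\<Sum>i\<in>UNIV. Poly_Mapping.single (\<sigma> i) (Poly_Mapping.lookup m i)) = perm_exp \<sigma> m" for m :: "'a \<Rightarrow>\<^sub>0 nat"
  proof (rule poly_mapping_eqI)
    fix j
    have "\<sigma> i = j \<longleftrightarrow> i = inv \<sigma> j" for i using permutes_inv_eq[OF assms, of j i] by auto
    then show "Poly_Mapping.lookup (\<Sum>i\<in>UNIV. Poly_Mapping.single (\<sigma> i) (Poly_Mapping.lookup m i)) j =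
        Poly_Mapping.lookup (perm_exp \<sigma> m) j"
      by (simp add: lookup_sum lookup_single when_def)
  qed
  then show ?thesis
    unfolding perm_act_def by (simp add: var_power prod_single const_mult_single)
qed

lemma lookup_perm_act:
  assumes "\<sigma> permutes UNIV"
  shows "Poly_Mapping.lookup (perm_act \<sigma> f) m = Poly_Mapping.lookup f (exp_of (\<lambda>i. Poly_Mapping.lookup m (\<sigma> i)))"
  by (simp add: perm_act_altdef[OF assms] lookup_sum lookup_single when_def perm_exp_eq_iff[OF assms] in_keys_iff)

lemma perm_act_single:
  "\<sigma> permutes UNIV \<Longrightarrow> perm_act \<sigma> (Poly_Mapping.single m c) = Poly_Mapping.single (perm_exp \<sigma> m) c"
  by (simp add: perm_act_altdef)

lemma perm_act_add: "\<sigma> permutes UNIV \<Longrightarrow> perm_act \<sigma> (f + g) = perm_act \<sigma> f + perm_act \<sigma> g"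
  by (rule poly_mapping_eqI) (simp add: lookup_perm_act lookup_add)

lemma perm_rep_mpoly: "perm_rep (\<lambda>c p. const c * p) (perm_act :: ('n \<Rightarrow> 'n) \<Rightarrow> ('n::finite, 'k::field) mpoly \<Rightarrow> _)"
proof (intro perm_rep.intro perm_rep_axioms.intro mpoly_vs.vector_space_axioms)
  fix \<sigma> \<tau> :: "'n \<Rightarrow> 'n" and x y :: "('n, 'k) mpoly" and c
  show "perm_act id x = x"
    by (rule poly_mapping_eqI) (simp add: lookup_perm_act permutes_id)
  assume \<sigma>: "\<sigma> permutes UNIV"
  then show "perm_act \<sigma> (x + y) = perm_act \<sigma> x + perm_act \<sigma> y" by (rule perm_act_add)
  from \<sigma> show "perm_act \<sigma> (const c * x) = const c * perm_act \<sigma> x"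
    by (intro poly_mapping_eqI) (simp add: lookup_perm_act lookup_const_mult)
  assume \<tau>: "\<tau> permutes UNIV"
  show "perm_act (\<sigma> \<circ> \<tau>) x = perm_act \<sigma> (perm_act \<tau> x)"
    by (rule poly_mapping_eqI) (simp add: lookup_perm_act \<sigma> \<tau> permutes_compose[OF \<tau> \<sigma>])
qed

lemma perm_act_mult:
  assumes \<sigma>: "\<sigma> permutes UNIV"
  shows "perm_act \<sigma> (f * g) = perm_act \<sigma> f * perm_act \<sigma> g"
proof -
  have act_sum: "perm_act \<sigma> (sum h A) = (\<Sum>i\<in>A. perm_act \<sigma> (h i))" for h and A :: "'x set"
    by (rule perm_rep.act_sum[OF perm_rep_mpoly \<sigma>])
  have perm_exp_add: "perm_exp \<sigma> (a + b) = perm_exp \<sigma> a + perm_exp \<sigma> b" for a b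
    by (rule poly_mapping_eqI) (simp add: lookup_add)
  have "perm_act \<sigma> (f * g) = perm_act \<sigma> (\<Sum>a\<in>Poly_Mapping.keys f. \<Sum>b\<in>Poly_Mapping.keys g.
      Poly_Mapping.single a (Poly_Mapping.lookup f a) * Poly_Mapping.single b (Poly_Mapping.lookup g b))"
    by (simp only: sum_product[symmetric] sum_single_lookup)
  also have "\<dots> = (\<Sum>a\<in>Poly_Mapping.keys f. \<Sum>b\<in>Poly_Mapping.keys g.
      Poly_Mapping.single (perm_exp \<sigma> a) (Poly_Mapping.lookup f a) * Poly_Mapping.single (perm_exp \<sigma> b) (Poly_Mapping.lookup g b))"
    unfolding perm_rep.act_sum[OF perm_rep_mpoly \<sigma>]
    by (intro sum.cong refl) (simp add: mult_single perm_act_single[OF \<sigma>] perm_exp_add)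
  also have "\<dots> = perm_act \<sigma> f * perm_act \<sigma> g"
    by (simp only: perm_act_altdef[OF \<sigma>] sum_product)
  finally show ?thesis .
qed

text \<open>Modulo higher degree, the ideal generated by a subspace of the degree-\<open>d\<close> component is that
  subspace.\<close>

lemma ideal_span_decomp:
  assumes X: "mpoly_vs.subspace X" "X \<subseteq> hom_comp d" and p: "p \<in> mpoly_ring.span X"
  obtains x q where "x \<in> X" "p = x + q" "\<And>m. m \<in> Poly_Mapping.keys q \<Longrightarrow> d < (\<Sum>i\<in>UNIV. Poly_Mapping.lookup m i)"
proof -
  let ?high = "\<lambda>q. \<forall>m\<in>Poly_Mapping.keys q. d < (\<Sum>i\<in>UNIV. Poly_Mapping.lookup m i)"
  have "\<exists>x\<in>X. \<exists>q. p = x + q \<and> ?high q"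
    using p
  proof (induction rule: mpoly_ring.span_induct_alt)
    case base
    show ?case using mpoly_vs.subspace_0[OF X(1)] by (intro bexI[of _ 0] exI[of _ 0]) simp_all
  next
    case (step c x y)
    then obtain x' q where y: "x' \<in> X" "y = x' + q" "?high q" by blast
    \<comment> \<open>Only the constant term of the coefficient \<open>c\<close> keeps
      \<open>x\<close> in degree \<open>d\<close>; every other term of \<open>c\<close> raises the
      degree.\<close>
    define c0 where "c0 = Poly_Mapping.lookup c 0"
    define q' where "q' = (c - const c0) * x"
    have "?high q'"
    proof
      fix m assume "m \<in> Poly_Mapping.keys q'"
      then obtain a b where ab: "m = a + b" "a \<in> Poly_Mapping.keys (c - const c0)" "b \<in> Poly_Mapping.keys x"
        using keys_mult[of "c - const c0" x] unfolding q'_def by blast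
      have "a \<noteq> 0"
        using ab(2) unfolding c0_def const_def by (auto simp: in_keys_iff lookup_minus lookup_single)
      then obtain i where "Poly_Mapping.lookup a i \<noteq> 0" by (metis lookup_zero poly_mapping_eqI)
      then have "0 < (\<Sum>i\<in>UNIV. Poly_Mapping.lookup a i)"
        by (metis UNIV_I finite_class.finite_UNIV gr0I sum_eq_0_iff)
      moreover have "(\<Sum>i\<in>UNIV. Poly_Mapping.lookup b i) = d"
        using ab(3) step(1) X(2) unfolding hom_comp_def by blast
      ultimately show "d < (\<Sum>i\<in>UNIV. Poly_Mapping.lookup m i)"
        unfolding ab(1) by (simp add: lookup_add sum.distrib)
    qed
    then have "?high (q' + q)" using y(3) keys_add[of q' q] by blast
    moreover have "const c0 * x + x' \<in> X"
      using mpoly_vs.subspace_add[OF X(1) mpoly_vs.subspace_scale[OF X(1) step(1)] y(1)] .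
    moreover have "c * x + y = (const c0 * x + x') + (q' + q)"
      unfolding q'_def y(2) by (simp add: algebra_simps)
    ultimately show ?case by blast
  qed
  then show thesis using that by blast
qed

lemma ideal_span_Int_hom_comp:
  assumes X: "mpoly_vs.subspace X" "X \<subseteq> hom_comp d"
  shows "mpoly_ring.span X \<inter> hom_comp d = X"
proof (intro set_eqI iffI)
  fix p assume p: "p \<in> mpoly_ring.span X \<inter> hom_comp d"
  then obtain x q where xq: "x \<in> X" "p = x + q" "\<And>m. m \<in> Poly_Mapping.keys q \<Longrightarrow> d < (\<Sum>i\<in>UNIV. Poly_Mapping.lookup m i)"
    using ideal_span_decomp[OF X] by blast
  have "q = 0"
  proof (rule ccontr)
    assume "q \<noteq> 0"
    then obtain m where m: "m \<in> Poly_Mapping.keys q" by (metis ex_in_conv keys_eq_empty)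
    then have "m \<notin> exps d" using xq(3)[OF m] unfolding exps_def by simp
    then have "Poly_Mapping.lookup p m = 0" "Poly_Mapping.lookup x m = 0"
      using p xq(1) X(2) hom_comp_iff by blast+
    then show False using m unfolding xq(2) by (simp add: in_keys_iff lookup_add)
  qed
  then show "p \<in> X" using xq by simp
qed (use X(2) mpoly_ring.span_base in blast)

text \<open>Pins down the degree of generators, which \<open>generated_up_to_symmetry\<close> leaves
  open.\<close>

lemma ideal_span_degree_ge:
  assumes "mpoly_vs.subspace X" "X \<subseteq> hom_comp d" "p \<in> mpoly_ring.span X" "p \<in> hom_comp e" "p \<noteq> 0"
  shows "d \<le> e"
proof -
  obtain x q where xq: "x \<in> X" "p = x + q" "\<And>m. m \<in> Poly_Mapping.keys q \<Longrightarrow> d < (\<Sum>i\<in>UNIV. Poly_Mapping.lookup m i)"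
    using ideal_span_decomp[OF assms(1,2,3)] by blast
  obtain m where m: "m \<in> Poly_Mapping.keys p" using assms(5) by (metis ex_in_conv keys_eq_empty)
  then have "m \<in> Poly_Mapping.keys x \<or> m \<in> Poly_Mapping.keys q" using keys_add[of x q] xq(2) by blast
  moreover have "(\<Sum>i\<in>UNIV. Poly_Mapping.lookup m i) = e" using m assms(4) unfolding hom_comp_def by blast
  ultimately show ?thesis using xq(3)[of m] xq(1) assms(2) unfolding hom_comp_def by force
qed

text \<open>Allows an orbit span, a vector space, to replace the orbit itself as a generating set of
  an ideal.\<close>

lemma ideal_span_vs_span: "mpoly_ring.span (mpoly_vs.span S) = mpoly_ring.span S"
proof
  have "mpoly_vs.subspace (mpoly_ring.span S)"
    unfolding mpoly_vs.subspace_def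
    using mpoly_ring.span_zero mpoly_ring.span_add mpoly_ring.span_scale by blast
  then have "mpoly_vs.span S \<subseteq> mpoly_ring.span S"
    by (rule mpoly_vs.span_minimal[OF mpoly_ring.span_superset])
  then show "mpoly_ring.span (mpoly_vs.span S) \<subseteq> mpoly_ring.span S"
    by (metis mpoly_ring.span_minimal mpoly_ring.subspace_span)
  show "mpoly_ring.span S \<subseteq> mpoly_ring.span (mpoly_vs.span S)"
    by (rule mpoly_ring.span_mono[OF mpoly_vs.span_superset])
qed

lemma symmetric_ideal_span:
  assumes "\<And>\<sigma> x. \<sigma> permutes UNIV \<Longrightarrow> x \<in> X \<Longrightarrow> perm_act \<sigma> x \<in> X"
  shows "symmetric_ideal (mpoly_ring.span X)"
  unfolding symmetric_ideal_def
proof (intro conjI allI impI image_subsetI mpoly_ring.subspace_span)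
  fix \<sigma> :: "'a \<Rightarrow> 'a" and p assume \<sigma>: "\<sigma> permutes UNIV" and p: "p \<in> mpoly_ring.span X"
  from p show "perm_act \<sigma> p \<in> mpoly_ring.span X"
  proof (induction rule: mpoly_ring.span_induct_alt)
    case base
    show ?case using perm_rep.act_0[OF perm_rep_mpoly \<sigma>] mpoly_ring.span_zero by metis
  next
    case (step c x y)
    show ?case
      unfolding perm_act_add[OF \<sigma>] perm_act_mult[OF \<sigma>]
      by (intro mpoly_ring.span_add mpoly_ring.span_scale mpoly_ring.span_base step assms \<sigma>)
  qed
qed

text \<open>In a sorted list each ascent introduces a new value, and every value but the first is
  introduced in this way.\<close>

lemma card_ascents:
  assumes "sorted xs" "xs \<noteq> []"
  shows "card {i. Suc i < length xs \<and> xs ! i < xs ! Suc i} = card (set xs - {hd xs})"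
  using assms
proof (induction xs rule: induct_list012)
  case (3 x y zs)
  let ?A = "\<lambda>xs :: 'a list. {i. Suc i < length xs \<and> xs ! i < xs ! Suc i}"
  have A: "?A (x # y # zs) = (if x < y then {0} else {}) \<union> Suc ` ?A (y # zs)"
  proof (intro set_eqI iffI)
    fix i assume i: "i \<in> ?A (x # y # zs)"
    show "i \<in> (if x < y then {0} else {}) \<union> Suc ` ?A (y # zs)"
      using i by (cases i) auto
  qed (auto split: if_splits)
  have fin: "finite (?A (y # zs))" by (rule finite_subset[of _ "{..<length (y # zs)}"]) auto
  have IH: "card (?A (y # zs)) = card (set (y # zs) - {y})" using "3.IH"(2) "3.prems"(1) by simp
  show ?case
  proof (cases "x < y")
    case True
    have "x \<notin> set (y # zs)" using "3.prems"(1) True by auto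
    then have "set (x # y # zs) - {x} = insert y (set (y # zs) - {y})" by auto
    then have "card (set (x # y # zs) - {x}) = Suc (card (set (y # zs) - {y}))" by (metis List.finite_set Diff_iff card_insert_disjoint finite_Diff singletonI)
    moreover have "card (?A (x # y # zs)) = Suc (card (?A (y # zs)))"
      unfolding A using True fin by (simp add: card_image)
    ultimately show ?thesis using IH by simp
  next
    case False
    then have "x = y" using "3.prems"(1) by simp
    then have "set (x # y # zs) - {x} = set (y # zs) - {y}" by auto
    moreover have "card (?A (x # y # zs)) = card (?A (y # zs))"
      unfolding A using False by (simp add: card_image)
    ultimately show ?thesis using IH by simp
  qed
qed simp_all

section \<open>The degree component as a permutation representation\<close>

text \<open>The sorted exponent vector, a complete invariant of the orbit of a monomial.\<close>

definition type_of :: "('n::finite \<Rightarrow>\<^sub>0 nat) \<Rightarrow> nat list" where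
  "type_of m = sorted_list_of_multiset (image_mset (Poly_Mapping.lookup m) (mset_set UNIV))"

lemma mset_type_of: "mset (type_of m) = image_mset (Poly_Mapping.lookup m) (mset_set UNIV)"
  unfolding type_of_def by simp

lemma type_of_perm_exp:
  assumes "\<sigma> permutes UNIV"
  shows "type_of (perm_exp \<sigma> m) = type_of m"
proof -
  have "image_mset (inv \<sigma>) (mset_set UNIV) = mset_set UNIV"
    using permutes_inv[OF assms] by (subst image_mset_mset_set) (auto simp: permutes_inj permutes_surj)
  moreover have "image_mset (Poly_Mapping.lookup (perm_exp \<sigma> m)) (mset_set UNIV) =
      image_mset (Poly_Mapping.lookup m) (image_mset (inv \<sigma>) (mset_set UNIV))"
    by (simp add: image_mset.compositionality o_def perm_exp_def)
  ultimately have "image_mset (Poly_Mapping.lookup (perm_exp \<sigma> m)) (mset_set UNIV) =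
      image_mset (Poly_Mapping.lookup m) (mset_set UNIV)" by simp
  then show ?thesis unfolding type_of_def by simp
qed

lemma type_of_in_sorted_lists:
  fixes m :: "'n::finite \<Rightarrow>\<^sub>0 nat"
  assumes "m \<in> exps d"
  shows "type_of m \<in> sorted_lists (card (UNIV :: 'n set)) d"
proof -
  have "length (type_of m) = card (UNIV :: 'n set)"
    by (subst size_mset[symmetric]) (simp add: mset_type_of)
  moreover have "sum_list (type_of m) = d"
    using assms unfolding exps_def
    by (subst sum_mset_sum_list[symmetric]) (simp add: mset_type_of sum_unfold_sum_mset)
  moreover have "sorted (type_of m)" unfolding type_of_def by simp
  ultimately show ?thesis unfolding sorted_lists_def by blast
qed

locale monomial_rep =
  fixes h :: "nat \<Rightarrow> 'n::finite" and n d :: nat and field_type :: "'k::field itself"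
  assumes h: "bij_betw h {..<n} UNIV"
    and fact_ne_0: "(of_nat (fact n) :: 'k) \<noteq> 0"
    and d: "d < n"
begin

lemma card_UNIV: "card (UNIV :: 'n set) = n"
  using bij_betw_same_card[OF h] by simp

definition mon_of :: "nat list \<Rightarrow> ('n \<Rightarrow>\<^sub>0 nat)" where
  "mon_of xs = exp_of (\<lambda>j. xs ! inv_into {..<n} h j)"

lemma lookup_mon_of: "i < n \<Longrightarrow> Poly_Mapping.lookup (mon_of xs) (h i) = xs ! i"
  unfolding mon_of_def using h by (simp add: bij_betw_def)

lemma image_mset_mon_of:
  assumes "length xs = n"
  shows "image_mset (Poly_Mapping.lookup (mon_of xs)) (mset_set UNIV) = mset xs"
proof -
  have "mset_set UNIV = image_mset h (mset_set {..<n})"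
    using h by (subst image_mset_mset_set) (auto simp: bij_betw_def)
  then have "image_mset (Poly_Mapping.lookup (mon_of xs)) (mset_set UNIV) =
      image_mset (\<lambda>i. Poly_Mapping.lookup (mon_of xs) (h i)) (mset_set {..<n})"
    by (simp add: image_mset.compositionality o_def)
  also have "\<dots> = image_mset ((!) xs) (mset_set {..<n})"
    by (intro image_mset_cong) (simp add: lookup_mon_of)
  also have "\<dots> = mset (map ((!) xs) [0..<n])"
    by (simp add: atLeast0LessThan)
  also have "map ((!) xs) [0..<n] = xs" using assms map_nth by blast
  finally show ?thesis .
qed

lemma type_of_mon_of: "xs \<in> sorted_lists n d' \<Longrightarrow> type_of (mon_of xs) = xs"
  unfolding type_of_def sorted_lists_def by (simp add: image_mset_mon_of sorted_sort_id)

lemma mon_of_in_exps: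
  assumes "xs \<in> sorted_lists n d'"
  shows "mon_of xs \<in> exps d'"
proof -
  have "(\<Sum>i\<in>UNIV. Poly_Mapping.lookup (mon_of xs) i) = sum_mset (mset xs)"
    using assms image_mset_mon_of[of xs] unfolding sorted_lists_def sum_unfold_sum_mset by simp
  then show ?thesis using assms unfolding exps_def sorted_lists_def by (simp add: sum_mset_sum_list)
qed

lemma type_of_in: "m \<in> exps d' \<Longrightarrow> type_of m \<in> sorted_lists n d'" for m :: "'n \<Rightarrow>\<^sub>0 nat"
  using type_of_in_sorted_lists[of m d'] card_UNIV by simp

text \<open>Both monomials have the same multiset of exponents, so a permutation of the variables
  matches them.\<close>

lemma perm_exp_mon_of_type_of:
  assumes "m \<in> exps d'"
  obtains \<sigma> where "\<sigma> permutes UNIV" "perm_exp \<sigma> (mon_of (type_of m)) = m"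
proof -
  have "length (type_of m) = n" using type_of_in[OF assms] unfolding sorted_lists_def by blast
  then have "image_mset (Poly_Mapping.lookup (mon_of (type_of m))) (mset_set UNIV) =
      image_mset (Poly_Mapping.lookup m) (mset_set UNIV)"
    by (simp only: image_mset_mon_of mset_type_of)
  then obtain \<sigma> where \<sigma>: "\<sigma> permutes UNIV"
      "\<forall>x\<in>UNIV. Poly_Mapping.lookup (mon_of (type_of m)) x = Poly_Mapping.lookup m (\<sigma> x)"
    using image_mset_eq_implies_permutes[OF finite_UNIV] by blast
  then have "mon_of (type_of m) = exp_of (\<lambda>i. Poly_Mapping.lookup m (\<sigma> i))"
    by (intro poly_mapping_eqI) simp
  then show thesis using that \<sigma>(1) perm_exp_eq_iff[OF \<sigma>(1)] by blast
qed

abbreviation monomial :: "('n \<Rightarrow>\<^sub>0 nat) \<Rightarrow> ('n, 'k) mpoly" where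
  "monomial m \<equiv> Poly_Mapping.single m 1"

lemma sum_const_monomial:
  assumes "finite A"
  shows "Poly_Mapping.lookup (\<Sum>m\<in>A. const (c m) * monomial m) k = (if k \<in> A then c k else 0)"
  using assms by (simp add: const_mult_single lookup_sum lookup_single when_def)

lemma independent_monomials: "mpoly_vs.independent (monomial ` exps d')"
proof (rule mpoly_vs.independent_if_scalars_zero)
  show "finite (monomial ` exps d')" by (rule finite_imageI[OF finite_exps])
  fix f x assume 0: "(\<Sum>x\<in>monomial ` exps d'. const (f x) * x) = 0" and "x \<in> monomial ` exps d'"
  then obtain m where m: "m \<in> exps d'" "x = monomial m" by blast
  have inj: "inj_on monomial (exps d')" by (rule inj_onI) (metis lookup_single_eq lookup_single_not_eq zero_neq_one)
  have "(\<Sum>m\<in>exps d'. const (f (monomial m)) * monomial m) = 0"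
    using 0 by (simp add: sum.reindex[OF inj])
  then have "Poly_Mapping.lookup (\<Sum>m\<in>exps d'. const (f (monomial m)) * monomial m) m = 0" by simp
  then show "f x = 0" using m by (simp add: sum_const_monomial[OF finite_exps])
qed

lemma span_monomials: "mpoly_vs.span (monomial ` exps d') = hom_comp d'"
proof
  show "mpoly_vs.span (monomial ` exps d') \<subseteq> hom_comp d'"
  proof (rule mpoly_vs.span_minimal)
    show "monomial ` exps d' \<subseteq> hom_comp d'" by (auto simp: hom_comp_iff lookup_single when_def)
    show "mpoly_vs.subspace (hom_comp d' :: ('n, 'k) mpoly set)"
    proof (rule mpoly_vs.subspaceI)
      fix x y :: "('n, 'k) mpoly" assume "x \<in> hom_comp d'" "y \<in> hom_comp d'"
      then show "x + y \<in> hom_comp d'" unfolding hom_comp_iff lookup_add by (metis add_0)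
    qed (simp_all add: hom_comp_iff lookup_const_mult)
  qed
  show "hom_comp d' \<subseteq> mpoly_vs.span (monomial ` exps d')"
  proof
    fix f :: "('n, 'k) mpoly" assume f: "f \<in> hom_comp d'"
    have "f = (\<Sum>m\<in>exps d'. const (Poly_Mapping.lookup f m) * monomial m)"
      using f by (intro poly_mapping_eqI) (auto simp: sum_const_monomial[OF finite_exps] hom_comp_iff)
    also have "\<dots> \<in> mpoly_vs.span (monomial ` exps d')"
      by (intro mpoly_vs.span_sum mpoly_vs.span_scale mpoly_vs.span_base) blast
    finally show "f \<in> mpoly_vs.span (monomial ` exps d')" .
  qed
qed

text \<open>The monomials of degree \<open>d\<close> form the permuted basis; those with sorted
  exponents along \<open>h\<close> represent the orbits, so orbits are indexed by
  partitions.\<close>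

sublocale R: perm_basis_rep "\<lambda>c p. const c * p" "perm_act :: ('n \<Rightarrow> 'n) \<Rightarrow> ('n, 'k) mpoly \<Rightarrow> _"
  "monomial ` exps d" "sorted_lists n d" "\<lambda>xs. monomial (mon_of xs)"
proof (intro perm_basis_rep.intro nonmodular_perm_rep.intro nonmodular_perm_rep_axioms.intro
    perm_basis_rep_axioms.intro perm_rep_mpoly independent_monomials)
  show "(of_nat (fact (card (UNIV :: 'n set))) :: 'k) \<noteq> 0" using fact_ne_0 card_UNIV by simp
  show "finite (monomial ` exps d)" by (rule finite_imageI[OF finite_exps])
  show "finite (sorted_lists n d)" by (rule finite_sorted_lists)
  show "perm_act \<sigma> b \<in> monomial ` exps d" if "\<sigma> permutes UNIV" "b \<in> monomial ` exps d" for \<sigma> :: "'n \<Rightarrow> 'n" and b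
    using that perm_exp_in_exps[OF that(1)] by (auto simp: perm_act_single)
  show "monomial (mon_of xs) \<in> monomial ` exps d" if "xs \<in> sorted_lists n d" for xs
    using mon_of_in_exps[OF that] by blast
  show "\<exists>xs\<in>sorted_lists n d. \<exists>\<sigma>. \<sigma> permutes UNIV \<and> perm_act \<sigma> (monomial (mon_of xs)) = b"
    if b: "b \<in> monomial ` exps d" for b
  proof -
    obtain m where m: "m \<in> exps d" "b = monomial m" using b by blast
    obtain \<sigma> where \<sigma>: "\<sigma> permutes UNIV" "perm_exp \<sigma> (mon_of (type_of m)) = m"
      using perm_exp_mon_of_type_of[OF m(1)] by blast
    then have "perm_act \<sigma> (monomial (mon_of (type_of m))) = b" by (simp add: perm_act_single m(2))
    then show ?thesis using \<sigma>(1) type_of_in[OF m(1)] by blast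
  qed
qed

lemma U_eq: "R.U = hom_comp d"
  unfolding R.U_def by (rule span_monomials)

text \<open>Number of pairs (partition of \<open>d\<close>, distinct part of it), which is the multiplicity of the
  standard representation in degree \<open>d\<close>.\<close>

definition num_std :: nat where
  "num_std = (\<Sum>j<d. card (sorted_lists n j))"

text \<open>The stabiliser of \<open>mon_of xs\<close> contains \<open>adj i\<close> whenever
  positions \<open>i\<close> and \<open>Suc i\<close> carry equal exponents, so
  \<open>stab_fixed\<close> lies in the corresponding fixed space. An element of \<open>Z\<close>
  that is invariant equals its average, which is 0.\<close>

lemma sum_dim_stab_fixed_le:
  assumes r: "num_std \<le> r * (n - 1)" and n: "n > 1"
    and Z: "mpoly_vs.subspace Z" "R.stable Z" "Z \<subseteq> R.N"
  shows "(\<Sum>xs\<in>sorted_lists n d. mpoly_vs.dim (R.stab_fixed Z xs)) \<le> r * mpoly_vs.dim Z"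
proof -
  have finZ: "mpoly_vs.finite_dim Z" by (rule mpoly_vs.finite_dim_subset[OF R.N(2) Z(3)])
  interpret C: chain_of_fixed_spaces "\<lambda>c p. const c * p" perm_act Z h n
  proof unfold_locales
    show "z = 0" if "z \<in> Z" "\<And>\<sigma>. \<sigma> permutes UNIV \<Longrightarrow> perm_act \<sigma> z = z" for z
      using that R.avg_fixed[of z] Z(3) unfolding R.N_def by auto
  qed (use Z finZ h in auto)
  have "R.stab_fixed Z xs \<subseteq> C.fixed {i. i < n - 1 \<and> xs ! i = xs ! Suc i}" for xs
  proof
    fix z assume z: "z \<in> R.stab_fixed Z xs"
    have "perm_act (C.adj i) z = z" if i: "i < n - 1" "xs ! i = xs ! Suc i" for i
    proof -
      have "mon_of xs = exp_of (\<lambda>j. Poly_Mapping.lookup (mon_of xs) (C.adj i j))"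
      proof (rule poly_mapping_eqI)
        fix j
        show "Poly_Mapping.lookup (mon_of xs) j =
            Poly_Mapping.lookup (exp_of (\<lambda>j. Poly_Mapping.lookup (mon_of xs) (C.adj i j))) j"
          using i lookup_mon_of[of i xs] lookup_mon_of[of "Suc i" xs]
          by (auto simp: C.adj_def transpose_def)
      qed
      then have "perm_exp (C.adj i) (mon_of xs) = mon_of xs"
        by (rule iffD2[OF perm_exp_eq_iff[OF C.adj_permutes]])
      then have "perm_act (C.adj i) (monomial (mon_of xs)) = monomial (mon_of xs)"
        by (simp only: perm_act_single[OF C.adj_permutes])
      then show ?thesis using z C.adj_permutes unfolding R.stab_fixed_def by blast
    qed
    then show "z \<in> C.fixed {i. i < n - 1 \<and> xs ! i = xs ! Suc i}"
      using z unfolding C.fixed_def R.stab_fixed_def by blast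
  qed
  then have "(\<Sum>xs\<in>sorted_lists n d. mpoly_vs.dim (R.stab_fixed Z xs)) \<le>
      (\<Sum>xs\<in>sorted_lists n d. mpoly_vs.dim (C.fixed {i. i < n - 1 \<and> xs ! i = xs ! Suc i}))"
    by (intro sum_mono mpoly_vs.finite_dim_dim_mono[OF C.fixed_finite_dim])
  then have "(n - 1) * (\<Sum>xs\<in>sorted_lists n d. mpoly_vs.dim (R.stab_fixed Z xs)) \<le>
      (n - 1) * (\<Sum>xs\<in>sorted_lists n d. mpoly_vs.dim (C.fixed {i. i < n - 1 \<and> xs ! i = xs ! Suc i}))"
    by (rule mult_le_mono2)
  also have "\<dots> \<le> num_std * mpoly_vs.dim Z"
    unfolding num_std_def by (rule C.sum_dim_fixed_le[OF d])
  also have "\<dots> \<le> r * (n - 1) * mpoly_vs.dim Z" using r by (rule mult_le_mono1)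
  finally have "(n - 1) * (\<Sum>xs\<in>sorted_lists n d. mpoly_vs.dim (R.stab_fixed Z xs)) \<le>
      (n - 1) * (r * mpoly_vs.dim Z)" by (simp add: ac_simps)
  then show ?thesis using n by (subst (asm) mult_le_cancel1) simp
qed

section \<open>Symmetric polynomials of degree \<open>d\<close>, and the spaces
  \<open>R.N + W\<close>\<close>

definition invariants :: "('n, 'k) mpoly set" where
  "invariants = {f \<in> hom_comp d. \<forall>\<sigma>. \<sigma> permutes UNIV \<longrightarrow> perm_act \<sigma> f = f}"

lemma subspace_invariants: "mpoly_vs.subspace invariants"
  using R.U(1) unfolding invariants_def U_eq mpoly_vs.subspace_def
  by (auto simp: R.act_add R.act_scale R.act_0)

lemma finite_dim_invariants: "mpoly_vs.finite_dim invariants"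
  by (rule mpoly_vs.finite_dim_subset[OF R.U(2)]) (auto simp: U_eq invariants_def)

lemma avg_invariants: "f \<in> invariants \<Longrightarrow> R.avg f = f"
  unfolding invariants_def by (rule R.avg_fixed) blast

lemma avg_in_invariants: "f \<in> hom_comp d \<Longrightarrow> R.avg f \<in> invariants"
  unfolding invariants_def using R.avg_in[OF R.U(1,3)] R.act_avg by (auto simp: U_eq)

lemma lookup_invariant:
  assumes f: "\<And>\<sigma>. \<sigma> permutes UNIV \<Longrightarrow> perm_act \<sigma> f = f" and m: "m \<in> exps d'"
  shows "Poly_Mapping.lookup f m = Poly_Mapping.lookup f (mon_of (type_of m))"
proof -
  obtain \<sigma> where \<sigma>: "\<sigma> permutes UNIV" "perm_exp \<sigma> (mon_of (type_of m)) = m"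
    using perm_exp_mon_of_type_of[OF m] by blast
  then have "mon_of (type_of m) = exp_of (\<lambda>i. Poly_Mapping.lookup m (\<sigma> i))"
    using perm_exp_eq_iff[OF \<sigma>(1)] by blast
  then show ?thesis using lookup_perm_act[OF \<sigma>(1), of f m] f[OF \<sigma>(1)] by simp
qed

end

lemma dim_fun_field:
  fixes I :: "'i set"
  assumes "finite I"
  shows "vector_space.dim (\<lambda>(c::'k::field) F i. c * F i) {F :: 'i \<Rightarrow> 'k. \<forall>i. i \<notin> I \<longrightarrow> F i = 0} = card I"
    and "vector_space.finite_dim (\<lambda>(c::'k::field) F i. c * F i) {F :: 'i \<Rightarrow> 'k. \<forall>i. i \<notin> I \<longrightarrow> F i = 0}"
    and "module.subspace (\<lambda>(c::'k::field) F i. c * F i) {F :: 'i \<Rightarrow> 'k. \<forall>i. i \<notin> I \<longrightarrow> F i = 0}"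
proof -
  interpret K: vector_space "(*) :: 'k \<Rightarrow> 'k \<Rightarrow> 'k" by unfold_locales (simp_all add: algebra_simps)
  have sp: "K.span {1} = UNIV"
  proof -
    have "x \<in> K.span {1}" for x using K.span_scale[of 1 "{1}" x] K.span_base[of 1 "{1}"] by simp
    then show ?thesis by blast
  qed
  have fin: "K.finite_dim UNIV" unfolding K.finite_dim_def using sp by (intro exI[of _ "{1}"]) simp
  have dim: "K.dim UNIV = 1" by (rule K.dim_unique[of "{1}"]) (simp_all add: sp)
  have eq: "{F :: 'i \<Rightarrow> 'k. \<forall>i. i \<notin> I \<longrightarrow> F i = 0} = {F. \<forall>i. if i \<in> I then F i \<in> UNIV else F i = 0}" by auto
  show "vector_space.dim (\<lambda>(c::'k::field) F i. c * F i) {F :: 'i \<Rightarrow> 'k. \<forall>i. i \<notin> I \<longrightarrow> F i = 0} = card I"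
    and "vector_space.finite_dim (\<lambda>(c::'k::field) F i. c * F i) {F :: 'i \<Rightarrow> 'k. \<forall>i. i \<notin> I \<longrightarrow> F i = 0}"
    unfolding eq using K.dim_fun[OF assms, of "\<lambda>_. UNIV"] fin dim by simp_all
  show "module.subspace (\<lambda>(c::'k::field) F i. c * F i) {F :: 'i \<Rightarrow> 'k. \<forall>i. i \<notin> I \<longrightarrow> F i = 0}"
    unfolding eq by (rule K.subspace_fun_extend) simp
qed

lemma vector_space_fun_field: "vector_space (\<lambda>(c::'k::field) (F :: 'i \<Rightarrow> 'k) i. c * F i)"
  by unfold_locales (simp_all add: plus_fun_def algebra_simps)

context monomial_rep
begin

text \<open>The coefficients at the sorted monomials serve as coordinates, since an invariant has
  constant coefficients on each orbit.\<close>

lemma dim_invariants: "mpoly_vs.dim invariants = card (sorted_lists n d)"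
proof -
  let ?L = "sorted_lists n d"
  interpret F: vector_space "\<lambda>(c::'k) (F :: nat list \<Rightarrow> 'k) i. c * F i" by (rule vector_space_fun_field)
  interpret P: vector_space_pair "\<lambda>c (p :: ('n, 'k) mpoly). const c * p" "\<lambda>(c::'k) (F :: nat list \<Rightarrow> 'k) i. c * F i"
    by unfold_locales
  define \<phi> where "\<phi> f = (\<lambda>xs. if xs \<in> ?L then Poly_Mapping.lookup f (mon_of xs) else 0)" for f :: "('n, 'k) mpoly"
  have lin: "Vector_Spaces.linear (\<lambda>c p. const c * p) (\<lambda>c F i. c * F i) \<phi>"
    unfolding Vector_Spaces.linear_iff \<phi>_def
    by (intro conjI mpoly_vs.vector_space_axioms F.vector_space_axioms allI ext)
      (simp_all add: lookup_add lookup_const_mult)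
  have "\<phi> ` invariants = {F. \<forall>i. i \<notin> ?L \<longrightarrow> F i = 0}"
  proof (intro set_eqI iffI)
    fix G assume "G \<in> {F :: nat list \<Rightarrow> 'k. \<forall>i. i \<notin> ?L \<longrightarrow> F i = 0}"
    then have G: "\<And>i. i \<notin> ?L \<Longrightarrow> G i = 0" by blast
    \<comment> \<open>The combination of monomial symmetric polynomials with prescribed coefficients
      \<open>G\<close>.\<close>
    define f where "f = (\<Sum>m\<in>exps d. const (G (type_of m)) * monomial m)"
    have lf: "Poly_Mapping.lookup f m = (if m \<in> exps d then G (type_of m) else 0)" for m
      unfolding f_def by (rule sum_const_monomial[OF finite_exps])
    have "perm_act \<sigma> f = f" if \<sigma>: "\<sigma> permutes UNIV" for \<sigma>
    proof (rule poly_mapping_eqI)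
      fix m
      define m' where "m' = exp_of (\<lambda>i. Poly_Mapping.lookup m (\<sigma> i))"
      have m': "perm_exp \<sigma> m' = m" using perm_exp_eq_iff[OF \<sigma>] unfolding m'_def by blast
      then show "Poly_Mapping.lookup (perm_act \<sigma> f) m = Poly_Mapping.lookup f m"
        unfolding lookup_perm_act[OF \<sigma>] m'_def[symmetric] lf
        using perm_exp_in_exps[OF \<sigma>, of m' d] type_of_perm_exp[OF \<sigma>, of m'] by simp
    qed
    then have "f \<in> invariants" unfolding invariants_def hom_comp_iff by (auto simp: lf)
    moreover have "\<phi> f = G"
      using G mon_of_in_exps type_of_mon_of unfolding \<phi>_def by (auto simp: fun_eq_iff lf)
    ultimately show "G \<in> \<phi> ` invariants" by blast
  qed (auto simp: \<phi>_def)
  moreover have "{f \<in> invariants. \<phi> f = 0} = {0}"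
  proof (intro set_eqI iffI)
    fix f assume "f \<in> {f \<in> invariants. \<phi> f = 0}"
    then have f: "f \<in> hom_comp d" "\<And>\<sigma>. \<sigma> permutes UNIV \<Longrightarrow> perm_act \<sigma> f = f" "\<phi> f = 0"
      unfolding invariants_def by auto
    have "Poly_Mapping.lookup f m = 0" for m
    proof (cases "m \<in> exps d")
      case True
      then have "\<phi> f (type_of m) = Poly_Mapping.lookup f m"
        unfolding \<phi>_def using lookup_invariant[OF f(2) True] type_of_in[OF True] by simp
      then show ?thesis using f(3) by simp
    qed (use f(1) hom_comp_iff in blast)
    then show "f \<in> {0}" by (simp add: poly_mapping_eqI)
  next
    fix f :: "('n, 'k) mpoly" assume "f \<in> {0}"
    then show "f \<in> {f \<in> invariants. \<phi> f = 0}"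
      using mpoly_vs.subspace_0[OF subspace_invariants] P.linear_0[OF lin] by auto
  qed
  moreover have "mpoly_vs.dim {0 :: ('n, 'k) mpoly} = 0"
    using mpoly_vs.finite_dim_eq_0_iff[of "{0}"] mpoly_vs.finite_dim_subset[OF finite_dim_invariants, of "{0}"]
      mpoly_vs.subspace_0[OF subspace_invariants] mpoly_vs.subspace_single_0 by blast
  ultimately show ?thesis
    using P.rank_nullity[OF lin subspace_invariants finite_dim_invariants]
      dim_fun_field(1)[OF finite_sorted_lists, of n d, where ?'k = 'k] by simp
qed

definition extension :: "('n, 'k) mpoly set \<Rightarrow> ('n, 'k) mpoly set" where
  "extension W = {x + w |x w. x \<in> R.N \<and> w \<in> W}"

lemma N_subset: "R.N \<subseteq> hom_comp d"
  unfolding R.N_def U_eq by blast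

lemma extension_invariants: "extension invariants = hom_comp d"
proof
  show "extension invariants \<subseteq> hom_comp d"
    unfolding extension_def invariants_def using N_subset mpoly_vs.subspace_add[OF R.U(1)] by (auto simp: U_eq)
  show "hom_comp d \<subseteq> extension invariants"
  proof
    fix x :: "('n, 'k) mpoly" assume x: "x \<in> hom_comp d"
    have "x = (x - R.avg x) + R.avg x" by simp
    then show "x \<in> extension invariants"
      unfolding extension_def using R.minus_avg_in_N[of x] avg_in_invariants[OF x] x U_eq by blast
  qed
qed

text \<open>The sum is direct: \<open>R.avg\<close> vanishes on \<open>R.N\<close> and is the
  identity on \<open>W\<close>.\<close>

lemma dim_extension:
  assumes W: "mpoly_vs.subspace W" "W \<subseteq> invariants"
  shows "mpoly_vs.dim (extension W) = mpoly_vs.dim R.N + mpoly_vs.dim W"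
proof -
  have finW: "mpoly_vs.finite_dim W" by (rule mpoly_vs.finite_dim_subset[OF finite_dim_invariants W(2)])
  have "x = 0" if "x \<in> R.N" "x \<in> W" for x
    using that avg_invariants[of x] W(2) unfolding R.N_def by auto
  then have "R.N \<inter> W = {0}"
    using mpoly_vs.subspace_0[OF R.N(1)] mpoly_vs.subspace_0[OF W(1)] by blast
  then have "mpoly_vs.dim (R.N \<inter> W) = 0"
    using mpoly_vs.finite_dim_eq_0_iff[OF mpoly_vs.finite_dim_subset[OF finW] mpoly_vs.subspace_inter[OF R.N(1) W(1)]] by blast
  then show ?thesis
    unfolding extension_def using mpoly_vs.dim_sums_Int[OF R.N(1,2) W(1) finW] by simp
qed

lemma extension_stable:
  assumes W: "mpoly_vs.subspace W" "W \<subseteq> invariants"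
  shows "mpoly_vs.subspace (extension W)" "R.stable (extension W)" "extension W \<subseteq> hom_comp d"
proof -
  show "mpoly_vs.subspace (extension W)"
    unfolding extension_def by (rule mpoly_vs.subspace_sums[OF R.N(1) W(1)])
  have "R.stable W" using W(2) unfolding R.stable_def invariants_def by fastforce
  then show "R.stable (extension W)" unfolding extension_def by (rule R.stable_sums[OF R.N(3)])
  show "extension W \<subseteq> hom_comp d"
    using W(2) unfolding extension_invariants[symmetric] extension_def by blast
qed

text \<open>Take \<open>g j = f j + w j\<close> with the \<open>f j\<close> generating
  \<open>R.N\<close>. Averaging returns \<open>w j\<close>, so the submodule generated by the
  \<open>g j\<close> contains both summands.\<close>

lemma extension_generated:
  assumes bound: "num_std \<le> r * (n - 1)" and n: "n > 1"
    and w: "\<And>j. j \<in> {1..r} \<Longrightarrow> w j \<in> invariants"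
  shows "\<exists>f. extension (mpoly_vs.span (w ` {1..r})) = R.orbit_span (f ` {1..r}) \<and> (\<forall>j\<in>{1..r}. f j \<in> hom_comp d)"
proof -
  let ?W = "mpoly_vs.span (w ` {1..r})"
  have W: "mpoly_vs.subspace ?W" "?W \<subseteq> invariants"
    by (rule mpoly_vs.subspace_span mpoly_vs.span_minimal[OF image_subsetI[OF w] subspace_invariants])+
  note ext = extension_stable[OF W]
  obtain f where f: "\<And>j. j \<in> {1..r} \<Longrightarrow> f j \<in> R.N" and gen: "R.orbit_span (f ` {1..r}) = R.N"
    using R.ex_orbit_span_eq_N[OF sum_dim_stab_fixed_le[OF bound n]] by blast
  define g where "g j = f j + w j" for j
  let ?Y = "R.orbit_span (g ` {1..r})"
  have g_ext: "g j \<in> extension ?W" if "j \<in> {1..r}" for j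
    unfolding g_def extension_def using f[OF that] mpoly_vs.span_base[of "w j" "w ` {1..r}"] that by blast
  have Y: "mpoly_vs.subspace ?Y" "R.stable ?Y" by (rule R.subspace_orbit_span R.stable_orbit_span)+
  have wY: "w j \<in> ?Y" if j: "j \<in> {1..r}" for j
  proof -
    have "R.avg (g j) = w j"
      unfolding g_def R.avg_add using f[OF j] avg_invariants[OF w[OF j]] by (simp add: R.N_def)
    moreover have "g j \<in> ?Y" using R.orbit_span_superset j by blast
    ultimately show ?thesis using R.avg_in[OF Y] by metis
  qed
  have fY: "f j \<in> ?Y" if j: "j \<in> {1..r}" for j
  proof -
    have "g j \<in> ?Y" using R.orbit_span_superset j by blast
    then have "g j - w j \<in> ?Y" using mpoly_vs.subspace_diff[OF Y(1)] wY[OF j] by blast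
    then show ?thesis unfolding g_def by simp
  qed
  have "R.N \<subseteq> ?Y" unfolding gen[symmetric] by (rule R.orbit_span_minimal[OF image_subsetI[OF fY] Y])
  moreover have "?W \<subseteq> ?Y" by (rule mpoly_vs.span_minimal[OF image_subsetI[OF wY] Y(1)])
  ultimately have "extension ?W \<subseteq> ?Y" unfolding extension_def using mpoly_vs.subspace_add[OF Y(1)] by blast
  moreover have "?Y \<subseteq> extension ?W" by (rule R.orbit_span_minimal[OF image_subsetI[OF g_ext] ext(1,2)])
  ultimately show ?thesis using g_ext ext(3) by blast
qed

end

section \<open>The lower bound on the number of variables\<close>

context monomial_rep
begin

text \<open>With fewer degrees than variables, some exponent is 0, and sorting puts it
  first.\<close>

lemma hd_sorted_lists:
  assumes "xs \<in> sorted_lists n d"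
  shows "xs \<noteq> []" "hd xs = 0"
proof -
  have xs: "length xs = n" "sorted xs" "sum_list xs = d" using assms unfolding sorted_lists_def by auto
  show ne: "xs \<noteq> []" using xs(1) d by auto
  show "hd xs = 0"
  proof (rule ccontr)
    assume "hd xs \<noteq> 0"
    then have "\<forall>x\<in>set xs. 1 \<le> x" using xs(2) ne by (cases xs) fastforce+
    then have "length xs \<le> sum_list xs" by (induction xs) auto
    then show False using xs d by simp
  qed
qed

lemma sum_card_nonzero_parts: "(\<Sum>xs\<in>sorted_lists n d. card (set xs - {0})) = num_std"
proof -
  have "(\<Sum>xs\<in>sorted_lists n d. card (set xs - {0})) =
      (\<Sum>xs\<in>sorted_lists n d. \<Sum>i=0..<n - 1. if xs ! i < xs ! Suc i then 1 else 0)"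
  proof (intro sum.cong refl)
    fix xs assume xs: "xs \<in> sorted_lists n d"
    then have "length xs = n" "sorted xs" unfolding sorted_lists_def by auto
    then have "card (set xs - {0}) = card {i. Suc i < n \<and> xs ! i < xs ! Suc i}"
      using card_ascents[of xs] hd_sorted_lists[OF xs] by simp
    also have "{i. Suc i < n \<and> xs ! i < xs ! Suc i} = {i \<in> {0..<n - 1}. xs ! i < xs ! Suc i}" by auto
    also have "card \<dots> = (\<Sum>i=0..<n - 1. if xs ! i < xs ! Suc i then 1 else 0)"
      by (simp add: sum.If_cases Int_def)
    finally show "card (set xs - {0}) = (\<Sum>i=0..<n - 1. if xs ! i < xs ! Suc i then 1 else 0)" .
  qed
  also have "\<dots> = (\<Sum>i=0..<n - 1. \<Sum>xs\<in>sorted_lists n d. if xs ! i < xs ! Suc i then 1 else 0)"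
    by (rule sum.swap)
  also have "\<dots> = (\<Sum>i=0..<n - 1. card {xs \<in> sorted_lists n d. xs ! i < xs ! Suc i})"
    by (intro sum.cong refl) (simp add: sum.If_cases finite_sorted_lists Int_def)
  also have "\<dots> = num_std" unfolding num_std_def by (rule sum_card_ascents[OF d])
  finally show ?thesis .
qed

definition pairing :: "(('n \<Rightarrow>\<^sub>0 nat) \<Rightarrow> 'k) \<Rightarrow> ('n, 'k) mpoly \<Rightarrow> 'k" where
  "pairing w f = (\<Sum>m\<in>exps d. Poly_Mapping.lookup f m * w m)"

lemma pairing_add: "pairing w (f + g) = pairing w f + pairing w g"
  unfolding pairing_def by (simp add: lookup_add distrib_right sum.distrib)

lemma pairing_scale: "pairing w (const c * f) = c * pairing w f"
  unfolding pairing_def by (simp add: lookup_const_mult sum_distrib_left mult.assoc)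

lemma pairing_0: "pairing w 0 = 0"
  unfolding pairing_def by simp

lemma pairing_sum: "pairing w (sum g A) = (\<Sum>i\<in>A. pairing w (g i))"
  by (induction A rule: infinite_finite_induct) (simp_all add: pairing_0 pairing_add)

lemma pairing_monomial: "m \<in> exps d \<Longrightarrow> pairing w (monomial m) = w m"
  unfolding pairing_def
  by (simp add: finite_exps lookup_single when_def if_distrib[of "\<lambda>x. x * _"] cong: if_cong)

lemma subspace_pairing_kernel: "mpoly_vs.subspace {f. pairing w f = 0}"
  by (rule mpoly_vs.subspaceI) (simp_all add: pairing_0 pairing_add pairing_scale)

lemma pairing_perm_act:
  assumes \<sigma>: "\<sigma> permutes UNIV"
  shows "pairing w (perm_act \<sigma> f) = pairing (\<lambda>m. w (perm_exp \<sigma> m)) f"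
proof -
  have inv: "exp_of (\<lambda>i. Poly_Mapping.lookup (perm_exp \<sigma> m) (\<sigma> i)) = m" for m :: "'n \<Rightarrow>\<^sub>0 nat"
    using perm_exp_eq_iff[OF \<sigma>, of m "perm_exp \<sigma> m"] by simp
  have "bij_betw (perm_exp \<sigma>) (exps d) (exps d)"
  proof (rule bij_betwI')
    fix m m' :: "'n \<Rightarrow>\<^sub>0 nat"
    show "perm_exp \<sigma> m = perm_exp \<sigma> m' \<longleftrightarrow> m = m'" using inv by metis
  next
    fix m :: "'n \<Rightarrow>\<^sub>0 nat" assume "m \<in> exps d"
    then show "perm_exp \<sigma> m \<in> exps d" using perm_exp_in_exps[OF \<sigma>] by blast
  next
    fix m' :: "'n \<Rightarrow>\<^sub>0 nat" assume m': "m' \<in> exps d"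
    define m where "m = exp_of (\<lambda>i. Poly_Mapping.lookup m' (\<sigma> i))"
    have "m' = perm_exp \<sigma> m" using perm_exp_eq_iff[OF \<sigma>, of m m'] unfolding m_def by simp
    then show "\<exists>m\<in>exps d. m' = perm_exp \<sigma> m" using m' perm_exp_in_exps[OF \<sigma>] by blast
  qed
  from sum.reindex_bij_betw[OF this]
  have reindex: "(\<Sum>m\<in>exps d. F (perm_exp \<sigma> m)) = (\<Sum>m\<in>exps d. F m)" for F :: "('n \<Rightarrow>\<^sub>0 nat) \<Rightarrow> 'k" .
  show ?thesis
    unfolding pairing_def lookup_perm_act[OF \<sigma>] by (subst reindex[symmetric]) (simp only: inv)
qed

text \<open>A weight that depends only on the type gives an invariant functional, so
  \<open>n!\<close> times its value at \<open>f\<close> is its value at the sum of all translates of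
  \<open>f\<close>, which is 0.\<close>

lemma pairing_type_N:
  assumes f: "f \<in> R.N"
  shows "pairing (\<lambda>m. F (type_of m)) f = 0"
proof -
  let ?w = "\<lambda>m. F (type_of m)"
  have "R.avg f = 0" using f unfolding R.N_def by blast
  then have "(\<Sum>\<sigma> | \<sigma> permutes UNIV. perm_act \<sigma> f) = 0"
    unfolding R.avg_def mpoly_vs.scale_eq_0_iff using R.fact_nonzero by simp
  then have "(\<Sum>\<sigma> | \<sigma> permutes UNIV. pairing ?w (perm_act \<sigma> f)) = 0"
    unfolding pairing_sum[symmetric] by (simp add: pairing_0)
  moreover have "(\<Sum>\<sigma> | \<sigma> permutes UNIV. pairing ?w (perm_act \<sigma> f)) =
      (\<Sum>\<sigma> | \<sigma> permutes (UNIV :: 'n set). pairing ?w f)"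
    by (intro sum.cong refl) (simp add: pairing_perm_act type_of_perm_exp)
  moreover have "card {\<sigma>. \<sigma> permutes (UNIV :: 'n set)} = fact n"
    by (rule card_permutations[OF card_UNIV finite_UNIV])
  ultimately show ?thesis using fact_ne_0 by simp
qed

text \<open>The functionals \<open>f \<mapsto> (sum of the coefficients of the monomials of type \<open>xs\<close> in which the variable
  \<open>j\<close> has exponent \<open>a\<close>)\<close>, for the pairs \<open>(xs, a)\<close> with \<open>a \<noteq> 0\<close> and fixed \<open>j\<close>, are linearly independent
  on \<open>R.N\<close>; for each pair their sum over all \<open>j\<close> vanishes on \<open>R.N\<close>, so that on a generator only \<open>n - 1\<close>
  of the values of each are free.\<close>

lemma num_std_le:
  assumes gen: "R.orbit_span (g ` {1..r}) = extension W"
    and W: "mpoly_vs.subspace W" "W \<subseteq> invariants"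
  shows "num_std \<le> r * (n - 1)"
proof -
  \<comment> \<open>The component of \<open>g i\<close> in \<open>R.N\<close>. Since
    \<open>x - R.avg x\<close> is equivariant, these components generate \<open>R.N\<close>.\<close>
  define f where "f i = g i - R.avg (g i)" for i
  have f_N: "f i \<in> R.N" if "i \<in> {1..r}" for i
  proof -
    have "g i \<in> hom_comp d" using R.orbit_span_superset gen extension_stable(3)[OF W] that by blast
    then show ?thesis unfolding f_def using R.minus_avg_in_N U_eq by blast
  qed
  have N_gen: "R.N \<subseteq> R.orbit_span (f ` {1..r})"
  proof
    fix x assume x: "x \<in> R.N"
    have "x + 0 \<in> extension W" unfolding extension_def using x mpoly_vs.subspace_0[OF W(1)] by blast
    then have "x \<in> R.orbit_span (g ` {1..r})" unfolding gen by simp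
    moreover have "R.orbit_span (g ` {1..r}) \<subseteq> {x. x - R.avg x \<in> R.orbit_span (f ` {1..r})}"
      unfolding R.orbit_span_def[of "g ` _"]
    proof (rule mpoly_vs.span_minimal)
      show "{perm_act \<sigma> s |\<sigma> s. \<sigma> permutes UNIV \<and> s \<in> g ` {1..r}} \<subseteq>
          {x. x - R.avg x \<in> R.orbit_span (f ` {1..r})}"
      proof safe
        fix \<sigma> :: "'n \<Rightarrow> 'n" and i assume \<sigma>: "\<sigma> permutes UNIV" and i: "i \<in> {1..r}"
        have "perm_act \<sigma> (g i) - R.avg (perm_act \<sigma> (g i)) = perm_act \<sigma> (f i)"
          unfolding f_def by (simp only: R.act_diff[OF \<sigma>] R.act_avg[OF \<sigma>] R.avg_act[OF \<sigma>])
        then show "perm_act \<sigma> (g i) - R.avg (perm_act \<sigma> (g i)) \<in> R.orbit_span (f ` {1..r})"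
          using R.orbit_span_base[OF \<sigma>, of "f i" "f ` {1..r}"] i by simp
      qed
      show "mpoly_vs.subspace {x. x - R.avg x \<in> R.orbit_span (f ` {1..r})}"
      proof (rule mpoly_vs.subspaceI)
        have "R.avg 0 = 0" using R.avg_diff[of 0 0] by simp
        then show "0 \<in> {x. x - R.avg x \<in> R.orbit_span (f ` {1..r})}"
          using mpoly_vs.subspace_0[OF R.subspace_orbit_span] by simp
      next
        fix x y assume "x \<in> {x. x - R.avg x \<in> R.orbit_span (f ` {1..r})}"
          "y \<in> {x. x - R.avg x \<in> R.orbit_span (f ` {1..r})}"
        then have "(x - R.avg x) + (y - R.avg y) \<in> R.orbit_span (f ` {1..r})"
          using mpoly_vs.subspace_add[OF R.subspace_orbit_span] by blast
        then show "x + y \<in> {x. x - R.avg x \<in> R.orbit_span (f ` {1..r})}"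
          by (simp only: mem_Collect_eq R.avg_add add_diff_add)
      next
        fix c x assume "x \<in> {x. x - R.avg x \<in> R.orbit_span (f ` {1..r})}"
        then have "const c * (x - R.avg x) \<in> R.orbit_span (f ` {1..r})"
          using mpoly_vs.subspace_scale[OF R.subspace_orbit_span] by blast
        then show "const c * x \<in> {x. x - R.avg x \<in> R.orbit_span (f ` {1..r})}"
          by (simp only: mem_Collect_eq R.avg_scale mpoly_vs.scale_right_diff_distrib)
      qed
    qed
    ultimately have "x - R.avg x \<in> R.orbit_span (f ` {1..r})" by blast
    then show "x \<in> R.orbit_span (f ` {1..r})" using x unfolding R.N_def by simp
  qed

  \<comment> \<open>\<open>P\<close> indexes the functionals, and \<open>T\<close> the values that
    are free on the generators: the value at the variable \<open>h 0\<close> is determined by the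
    others.\<close>
  define P where "P = (SIGMA xs:sorted_lists n d. set xs - {0})"
  define T where "T = {1..r} \<times> (UNIV - {h 0})"
  have finP: "finite P" unfolding P_def using finite_sorted_lists by blast
  have cardP: "card P = num_std"
    unfolding P_def sum_card_nonzero_parts[symmetric] by (rule card_SigmaI) (use finite_sorted_lists in auto)
  have finT: "finite T" and cardT: "card T = r * (n - 1)"
    unfolding T_def by (simp_all add: card_cartesian_product card_UNIV card_Diff_singleton)

  define L where "L c j = pairing (\<lambda>m. c (type_of m, Poly_Mapping.lookup m j))" for c :: "nat list \<times> nat \<Rightarrow> 'k" and j
  \<comment> \<open>Injectivity of this map on functions supported in \<open>P\<close> yields
    \<open>card P \<le> card T\<close>, the claim.\<close>
  define \<Lambda> where "\<Lambda> c = (\<lambda>p. if p \<in> T then L c (snd p) (f (fst p)) else 0)" for c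
  interpret FP: vector_space "\<lambda>(c::'k) (F :: nat list \<times> nat \<Rightarrow> 'k) i. c * F i" by (rule vector_space_fun_field)
  interpret FT: vector_space "\<lambda>(c::'k) (F :: nat \<times> 'n \<Rightarrow> 'k) i. c * F i" by (rule vector_space_fun_field)
  interpret PT: vector_space_pair "\<lambda>(c::'k) (F :: nat list \<times> nat \<Rightarrow> 'k) i. c * F i"
    "\<lambda>(c::'k) (F :: nat \<times> 'n \<Rightarrow> 'k) i. c * F i" by unfold_locales
  have "L (c + c') j x = L c j x + L c' j x" for c c' j x
    unfolding L_def pairing_def by (simp add: distrib_left sum.distrib)
  moreover have "L (\<lambda>p. a * c p) j x = a * L c j x" for a c j x
    unfolding L_def pairing_def by (simp add: sum_distrib_left mult.left_commute)
  ultimately have lin: "Vector_Spaces.linear (\<lambda>(c::'k) F i. c * F i) (\<lambda>c F i. c * F i) \<Lambda>"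
    unfolding Vector_Spaces.linear_iff \<Lambda>_def
    by (intro conjI FP.vector_space_axioms FT.vector_space_axioms allI ext) simp_all
  let ?D = "{c :: nat list \<times> nat \<Rightarrow> 'k. \<forall>p. p \<notin> P \<longrightarrow> c p = 0}"
  note D = dim_fun_field[OF finP, where ?'k = 'k]
  note E = dim_fun_field[OF finT, where ?'k = 'k]

  have "c = 0" if c: "c \<in> ?D" and ker: "\<Lambda> c = 0" for c
  proof
    have L_f: "L c j (f i) = 0" if i: "i \<in> {1..r}" for i j
    proof -
      have other: "L c j' (f i) = 0" if "j' \<noteq> h 0" for j'
        using fun_cong[OF ker, of "(i, j')"] that i unfolding \<Lambda>_def T_def by simp
      have "(\<Sum>j\<in>UNIV. c (type_of m, Poly_Mapping.lookup m j)) =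
          sum_mset (image_mset (\<lambda>a. c (type_of m, a)) (mset (type_of m)))" for m :: "'n \<Rightarrow>\<^sub>0 nat"
        unfolding mset_type_of sum_unfold_sum_mset by (simp add: image_mset.compositionality o_def)
      \<comment> \<open>Summing over all variables leaves a weight that depends only on the type of
        the monomial.\<close>
      then have "(\<Sum>j\<in>UNIV. L c j (f i)) =
          pairing (\<lambda>m. (\<lambda>xs. sum_mset (image_mset (\<lambda>a. c (xs, a)) (mset xs))) (type_of m)) (f i)"
        unfolding L_def pairing_def by (subst sum.swap) (simp add: sum_distrib_left[symmetric])
      also have "\<dots> = 0" by (rule pairing_type_N[OF f_N[OF i]])
      finally have "(\<Sum>j\<in>UNIV. L c j (f i)) = 0" .
      moreover have "(\<Sum>j\<in>UNIV. L c j (f i)) = L c (h 0) (f i) + (\<Sum>j\<in>UNIV - {h 0}. L c j (f i))"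
        by (rule sum.remove) simp_all
      moreover have "(\<Sum>j\<in>UNIV - {h 0}. L c j (f i)) = 0" by (rule sum.neutral) (use other in auto)
      ultimately show ?thesis using other by (cases "j = h 0") auto
    qed
    have L_N: "L c j x = 0" if x: "x \<in> R.N" for j x
    proof -
      have "R.orbit_span (f ` {1..r}) \<subseteq> {x. L c j x = 0}"
        unfolding R.orbit_span_def
      proof (rule mpoly_vs.span_minimal)
        show "mpoly_vs.subspace {x. L c j x = 0}" unfolding L_def by (rule subspace_pairing_kernel)
        show "{perm_act \<sigma> s |\<sigma> s. \<sigma> permutes UNIV \<and> s \<in> f ` {1..r}} \<subseteq> {x. L c j x = 0}"
        proof safe
          fix \<sigma> :: "'n \<Rightarrow> 'n" and i assume \<sigma>: "\<sigma> permutes UNIV" and i: "i \<in> {1..r}"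
          \<comment> \<open>Permuting the generator only changes the distinguished variable, so
            vanishing for all \<open>j\<close> passes to the orbits.\<close>
          have "L c j (perm_act \<sigma> (f i)) = L c (inv \<sigma> j) (f i)"
            unfolding L_def by (simp add: pairing_perm_act[OF \<sigma>] type_of_perm_exp[OF \<sigma>])
          then show "L c j (perm_act \<sigma> (f i)) = 0" using L_f[OF i] by simp
        qed
      qed
      then show ?thesis using N_gen x by blast
    qed
    fix p :: "nat list \<times> nat"
    show "c p = 0 p"
    proof (cases "p \<in> P")
      case True
      then obtain xs a where p: "p = (xs, a)" and xs: "xs \<in> sorted_lists n d" and a: "a \<in> set xs"
        unfolding P_def by blast
      have len: "length xs = n" using xs unfolding sorted_lists_def by blast
      obtain i where i: "i < n" "xs ! i = a" using a len by (metis in_set_conv_nth)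
      have x0: "xs ! 0 = 0" using hd_sorted_lists[OF xs] by (simp add: hd_conv_nth)
      \<comment> \<open>Swapping a variable of exponent \<open>a\<close> with one of exponent 0
        gives a difference of two monomials in \<open>R.N\<close>. On it the functional takes the
        value \<open>c (xs, a) - c (xs, 0)\<close>, and \<open>c (xs, 0)\<close> vanishes as
        \<open>P\<close> omits zero parts.\<close>
      define \<sigma> where "\<sigma> = Transposition.transpose (h 0) (h i)"
      have \<sigma>: "\<sigma> permutes UNIV" unfolding \<sigma>_def by (rule permutes_UNIV_transpose)
      let ?m = "mon_of xs"
      have m: "?m \<in> exps d" by (rule mon_of_in_exps[OF xs])
      have m': "perm_exp \<sigma> ?m \<in> exps d" using m perm_exp_in_exps[OF \<sigma>] by blast
      have act: "perm_act \<sigma> (monomial ?m) = monomial (perm_exp \<sigma> ?m)" by (rule perm_act_single[OF \<sigma>])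
      have "monomial ?m \<in> hom_comp d" "monomial (perm_exp \<sigma> ?m) \<in> hom_comp d"
        using m m' by (auto simp: hom_comp_iff lookup_single when_def)
      then have "monomial ?m - monomial (perm_exp \<sigma> ?m) \<in> hom_comp d"
        using mpoly_vs.subspace_diff[OF R.U(1)] U_eq by blast
      moreover have "R.avg (monomial ?m - monomial (perm_exp \<sigma> ?m)) = 0"
        unfolding act[symmetric] R.avg_diff R.avg_act[OF \<sigma>] by simp
      ultimately have "monomial ?m - monomial (perm_exp \<sigma> ?m) \<in> R.N" unfolding R.N_def U_eq by blast
      then have "L c (h i) (monomial ?m - monomial (perm_exp \<sigma> ?m)) = 0" by (rule L_N)
      moreover have "L c (h i) (monomial ?m) = L c (h i) (monomial ?m - monomial (perm_exp \<sigma> ?m)) +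
          L c (h i) (monomial (perm_exp \<sigma> ?m))"
        unfolding L_def pairing_add[symmetric] by simp
      ultimately have "L c (h i) (monomial ?m) = L c (h i) (monomial (perm_exp \<sigma> ?m))" by simp
      moreover have "L c (h i) (monomial ?m) = c (xs, a)"
        unfolding L_def pairing_monomial[OF m] by (simp add: type_of_mon_of[OF xs] lookup_mon_of i)
      moreover have "L c (h i) (monomial (perm_exp \<sigma> ?m)) = c (xs, 0)"
        unfolding L_def pairing_monomial[OF m'] type_of_perm_exp[OF \<sigma>]
        using d x0 by (simp add: type_of_mon_of[OF xs] \<sigma>_def lookup_mon_of)
      moreover have "c (xs, 0) = 0" using c unfolding P_def by simp
      ultimately show ?thesis using p by simp
    next
      case False
      then have "c p = 0" using c by blast
      then show ?thesis by (simp only: zero_fun_apply)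
    qed
  qed
  then have ker: "{c \<in> ?D. \<Lambda> c = 0} = {0}" using FP.subspace_0[OF D(3)] PT.linear_0[OF lin] by blast
  have "FP.dim {0} = 0"
    using FP.finite_dim_eq_0_iff[OF FP.finite_dim_subset[OF D(2), of "{0}"] FP.subspace_single_0] FP.subspace_0[OF D(3)]
    by blast
  then have "num_std = FT.dim (\<Lambda> ` ?D)"
    using PT.rank_nullity[OF lin D(3,2)] D(1) cardP unfolding ker by simp
  also have "\<dots> \<le> FT.dim {F :: nat \<times> 'n \<Rightarrow> 'k. \<forall>p. p \<notin> T \<longrightarrow> F p = 0}"
    by (rule FT.finite_dim_dim_mono[OF E(2)]) (auto simp: \<Lambda>_def)
  also have "\<dots> = r * (n - 1)" using E(1) cardT by simp
  finally show ?thesis .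
qed

section \<open>From ideals generated up to symmetry back to submodules of degree
  \<open>d\<close>\<close>

lemma hom_comp_subspace: "mpoly_vs.subspace (hom_comp e :: ('n, 'k) mpoly set)"
  unfolding span_monomials[symmetric] by (rule mpoly_vs.subspace_span)

lemma hom_comp_stable: "R.stable (hom_comp e)"
  unfolding R.stable_def
proof (intro allI impI)
  fix \<sigma> :: "'n \<Rightarrow> 'n" and f :: "('n, 'k) mpoly" assume \<sigma>: "\<sigma> permutes UNIV" and f: "f \<in> hom_comp e"
  show "perm_act \<sigma> f \<in> hom_comp e"
    unfolding hom_comp_iff
  proof (intro allI impI)
    fix m assume "Poly_Mapping.lookup (perm_act \<sigma> f) m \<noteq> 0"
    then have "exp_of (\<lambda>i. Poly_Mapping.lookup m (\<sigma> i)) \<in> exps e"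
      using f unfolding lookup_perm_act[OF \<sigma>] hom_comp_iff by blast
    moreover have "perm_exp \<sigma> (exp_of (\<lambda>i. Poly_Mapping.lookup m (\<sigma> i))) = m"
      using perm_exp_eq_iff[OF \<sigma>] by blast
    ultimately show "m \<in> exps e" using perm_exp_in_exps[OF \<sigma>] by metis
  qed
qed

lemma orbit_span_image:
  "R.orbit_span (f ` A) = mpoly_vs.span {perm_act \<sigma> (f i) |\<sigma> i. \<sigma> permutes UNIV \<and> i \<in> A}"
  unfolding R.orbit_span_def by (rule arg_cong[of _ _ mpoly_vs.span]) blast

text \<open>The generators have an unknown degree \<open>e\<close>. Each of the two generating
  spaces contains a nonzero element, lying in the ideal of the other, so \<open>e = d\<close>; then
  the degree \<open>d\<close> parts of the ideal are compared.\<close>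

lemma orbit_span_eq_extension_if_generated:
  assumes W: "mpoly_vs.subspace W" "W \<subseteq> invariants" and ne: "\<not> extension W \<subseteq> {0}"
    and gen: "generated_up_to_symmetry r (mpoly_ring.span (extension W))"
  shows "\<exists>f. R.orbit_span (f ` {1..r}) = extension W"
proof -
  let ?J = "mpoly_ring.span (extension W)"
  obtain f :: "nat \<Rightarrow> ('n, 'k) mpoly" and e where f: "\<forall>i\<in>{1..r}. f i \<in> hom_comp e"
    and J: "?J = mpoly_ring.span {perm_act \<sigma> (f i) |\<sigma> i. \<sigma> permutes UNIV \<and> i \<in> {1..r}}"
    using gen unfolding generated_up_to_symmetry_def by blast
  define X where "X = R.orbit_span (f ` {1..r})"
  have X: "mpoly_vs.subspace X" "X \<subseteq> hom_comp e"
    unfolding X_def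
    by (rule R.subspace_orbit_span)
      (rule R.orbit_span_minimal[OF image_subsetI[OF bspec[OF f]] hom_comp_subspace hom_comp_stable])
  have JX: "?J = mpoly_ring.span X" unfolding J X_def orbit_span_image by (rule ideal_span_vs_span[symmetric])
  note ext = extension_stable[OF W]
  obtain p where p: "p \<in> extension W" "p \<noteq> 0" using ne by blast
  have "p \<in> mpoly_ring.span X" using p(1) mpoly_ring.span_base unfolding JX[symmetric] by blast
  moreover have "p \<in> hom_comp d" using p(1) ext(3) by blast
  ultimately have "e \<le> d" by (rule ideal_span_degree_ge[OF X _ _ p(2)])
  have "\<not> X \<subseteq> {0}"
  proof
    assume "X \<subseteq> {0}"
    then have "mpoly_ring.span X \<subseteq> {0}" using mpoly_ring.span_mono[of X "{0}"] mpoly_ring.span_minimal[of "{0}" "{0}"] mpoly_ring.subspace_single_0 by blast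
    then show False using \<open>p \<in> mpoly_ring.span X\<close> p(2) by blast
  qed
  then obtain x where x: "x \<in> X" "x \<noteq> 0" by blast
  have "x \<in> ?J" unfolding JX by (rule mpoly_ring.span_base[OF x(1)])
  moreover have "x \<in> hom_comp e" using x(1) X(2) by blast
  ultimately have "d \<le> e" by (rule ideal_span_degree_ge[OF ext(1,3) _ _ x(2)])
  with \<open>e \<le> d\<close> have "e = d" by simp
  then have "X = mpoly_ring.span X \<inter> hom_comp d" using ideal_span_Int_hom_comp[OF X] by simp
  also have "\<dots> = extension W" unfolding JX[symmetric] by (rule ideal_span_Int_hom_comp[OF ext(1,3)])
  finally show ?thesis unfolding X_def by blast
qed

lemma generated_iff:
  assumes n: "n > 1" and w: "\<And>j. j \<in> {1..r} \<Longrightarrow> w j \<in> invariants"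
    and ne: "\<not> extension (mpoly_vs.span (w ` {1..r})) \<subseteq> {0}"
  shows "generated_up_to_symmetry r (mpoly_ring.span (extension (mpoly_vs.span (w ` {1..r})))) \<longleftrightarrow>
    num_std \<le> r * (n - 1)"
proof
  let ?W = "mpoly_vs.span (w ` {1..r})"
  have W: "mpoly_vs.subspace ?W" "?W \<subseteq> invariants"
    by (rule mpoly_vs.subspace_span mpoly_vs.span_minimal[OF image_subsetI[OF w] subspace_invariants])+
  show "num_std \<le> r * (n - 1)" if "generated_up_to_symmetry r (mpoly_ring.span (extension ?W))"
    using orbit_span_eq_extension_if_generated[OF W ne that] num_std_le[OF _ W] by blast
  show "generated_up_to_symmetry r (mpoly_ring.span (extension ?W))" if bound: "num_std \<le> r * (n - 1)"
  proof -
    obtain f where f: "extension ?W = R.orbit_span (f ` {1..r})" "\<forall>j\<in>{1..r}. f j \<in> hom_comp d"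
      using extension_generated[where w = w, OF bound n w] by blast
    then show ?thesis
      unfolding generated_up_to_symmetry_def f(1) orbit_span_image ideal_span_vs_span by blast
  qed
qed

end

section \<open>Choice of the ideal and the numerical form of the criterion\<close>

theorem mainTheorem4:
  fixes n d r :: nat
  assumes "infinite (UNIV :: 'k::field set)"
    and "CHAR('k) = 0 \<or> CHAR('k) > n"
    and "card (UNIV :: 'n::finite set) = n"
    and "n > d" and "d \<ge> 2"
    and "1 \<le> r" and "r \<le> num_partitions d"
  shows "\<exists>J :: ('n, 'k) mpoly set.
    symmetric_ideal J \<and> generated_in_degree d J \<and>
    int (mpoly_vs.dim (J \<inter> hom_comp d)) =
      int (mpoly_vs.dim (hom_comp d :: ('n, 'k) mpoly set)) - (int (num_partitions d) - int r) \<and>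
    (generated_up_to_symmetry r J \<longleftrightarrow>
      real n \<ge> 1 + real (\<Sum>i=0..d-1. num_partitions i) / real r)"
proof -
  obtain h :: "nat \<Rightarrow> 'n" where h: "bij_betw h {..<n} UNIV"
    using ex_bij_betw_nat_finite[of "UNIV :: 'n set"] assms(3) by (auto simp: atLeast0LessThan)
  \<comment> \<open>No factor of \<open>n!\<close> is divisible by a characteristic greater than
    \<open>n\<close>.\<close>
  have "(of_nat j :: 'k) \<noteq> 0" if "1 \<le> j" "j \<le> n" for j
    using assms(2) that unfolding of_nat_eq_0_iff_char_dvd by (auto dest: dvd_imp_le)
  then have "(of_nat (fact n) :: 'k) \<noteq> 0" by (simp add: fact_prod)
  then interpret M: monomial_rep h n d "TYPE('k)"
    using h assms(4) by unfold_locales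
  have dimI: "mpoly_vs.dim M.invariants = num_partitions d"
    using M.dim_invariants card_sorted_lists[of d n] assms(4) by simp
  obtain C where C: "C \<subseteq> M.invariants" "mpoly_vs.independent C" "card C = num_partitions d"
    using mpoly_vs.basis_exists[of M.invariants] dimI by metis
  \<comment> \<open>Any r elements of a basis of the symmetric polynomials will do: their span
    \<open>W\<close> has codimension \<open>P(d) - r\<close> there, and \<open>R.N + W\<close> has
    the same codimension in degree \<open>d\<close>.\<close>
  obtain C' where C': "C' \<subseteq> C" "card C' = r" using obtain_subset_with_card_n[of r C] C(3) assms(7) by auto
  have "finite C'" using C'(2) assms(6) by (metis card.infinite not_one_le_zero)
  then obtain w where w: "bij_betw w {1..r} C'" using ex_bij_betw_nat_finite_1[of C'] C'(2) by blast
  then have w_img: "w ` {1..r} = C'" unfolding bij_betw_def by blast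
  have w_inv: "w j \<in> M.invariants" if "j \<in> {1..r}" for j using that w_img C'(1) C(1) by blast
  define W where "W = mpoly_vs.span (w ` {1..r})"
  have W: "mpoly_vs.subspace W" "W \<subseteq> M.invariants"
    unfolding W_def
    by (rule mpoly_vs.subspace_span mpoly_vs.span_minimal[OF image_subsetI[OF w_inv] M.subspace_invariants])+
  have dimW: "mpoly_vs.dim W = r"
    unfolding W_def w_img using mpoly_vs.dim_span_eq_card_independent mpoly_vs.independent_mono[OF C(2) C'(1)] C'(2) by metis
  define J where "J = mpoly_ring.span (M.extension W)"
  note ext = M.extension_stable[OF W]
  have J_d: "J \<inter> hom_comp d = M.extension W" unfolding J_def by (rule ideal_span_Int_hom_comp[OF ext(1,3)])
  have dimJ: "mpoly_vs.dim (M.extension W) = mpoly_vs.dim M.R.N + r" using M.dim_extension[OF W] dimW by simp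
  have dimU: "mpoly_vs.dim (hom_comp d :: ('n, 'k) mpoly set) = mpoly_vs.dim M.R.N + num_partitions d"
    using M.dim_extension[OF M.subspace_invariants] dimI M.extension_invariants by simp
  have ne: "\<not> M.extension W \<subseteq> {0}"
  proof
    assume "M.extension W \<subseteq> {0}"
    then have "M.extension W \<subseteq> mpoly_vs.span {}" by (simp add: mpoly_vs.span_empty)
    then have "mpoly_vs.dim (M.extension W) \<le> 0" using mpoly_vs.dim_le_card[of _ "{}"] by simp
    then show False using dimJ assms(6) by simp
  qed
  \<comment> \<open>All \<open>j < d\<close> are below \<open>n\<close>, so counting lists of length
    \<open>n\<close> counts all partitions; \<open>d\<close> being positive, \<open>0..d-1\<close>
    is the same range.\<close>
  have "M.num_std = (\<Sum>i=0..d-1. num_partitions i)"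
    unfolding M.num_std_def using assms(4,5) by (intro sum.cong) (auto simp: card_sorted_lists)
  then have "M.num_std \<le> r * (n - 1) \<longleftrightarrow> real n \<ge> 1 + real (\<Sum>i=0..d-1. num_partitions i) / real r"
  proof -
    have "M.num_std \<le> r * (n - 1) \<longleftrightarrow> real M.num_std \<le> real r * (real n - 1)"
      using assms(4) by (subst of_nat_le_iff[where ?'a = real, symmetric]) (simp add: of_nat_diff)
    also have "\<dots> \<longleftrightarrow> real n \<ge> 1 + real M.num_std / real r" using assms(6) by (simp add: field_simps)
    finally show ?thesis using \<open>M.num_std = _\<close> by simp
  qed
  then have "generated_up_to_symmetry r J \<longleftrightarrow> real n \<ge> 1 + real (\<Sum>i=0..d-1. num_partitions i) / real r"
    using M.generated_iff[OF _ w_inv] ne assms(4,5) unfolding J_def W_def by simp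
  moreover have "symmetric_ideal J"
    unfolding J_def using ext(2) by (intro symmetric_ideal_span) (simp add: M.R.stable_def)
  moreover have "generated_in_degree d J"
    unfolding generated_in_degree_def J_def using ext(3) by blast
  moreover have "int (mpoly_vs.dim (J \<inter> hom_comp d)) =
      int (mpoly_vs.dim (hom_comp d :: ('n, 'k) mpoly set)) - (int (num_partitions d) - int r)"
    unfolding J_d dimJ dimU by simp
  ultimately show ?thesis by blast
qed

end
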